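(* Let $q>1$ and let $K:\ell^2(\mathbb{N})\to\ell^2(\mathbb{N})$ be the diagonal operator $Kv_j=\sigma_jv_j$ with $\sigma_j^2=j^{-q}$, where $(v_j)_{j\in\mathbb{N}}$ is the canonical orthonormal basis. Let $P_m:\ell^2(\mathbb{N})\to\mathbb{R}^m$ be the discretisation along the singular basis, i.e. $(P_mv_j)_l=(v_j,v_l)$ for $j\in\mathbb{N}$, $l=1,\dots,m$. Let $0<\varepsilon<2/11$ and let $Y_{ij}=(P_m\hat y)_j+\delta_{ij}$ be measurements of $\hat y\in\ell^2(\mathbb{N})$, where $(\delta_{ij})_{i,j\in\mathbb{N}}$ are i.i.d. with density $$f_\varepsilon(x)=\frac{c_\varepsilon}{|x|^{3+\varepsilon}}\chi_{(-\infty,-b_\varepsilon]\cup[b_\varepsilon,\infty)}(x),\qquad c_\varepsilon=\frac{\varepsilon^{1+\varepsilon/2}}{2(2+\varepsilon)^{\varepsilon/2}},\quad b_\varepsilon=\sqrt{\frac{\varepsilon}{2+\varepsilon}} .$$ Let $(R^{(m)}_\alpha)_{\alpha>0}$ be the spectral cut-off regularisation and let $c>0$. (a) If $\hat y=\sum_{j=1}^\infty j^{-\frac q2-1}v_j$ and $\alpha_{m,n}$ is determined by the discrepancy principle described in the context with right-hand side $\kappa_{m,n}=\tau\delta^{est}_{m,n}$, $\tau>1$, then there exists $C>0$ such that $$\lim_{\substack{m,n\to\infty\\ m/n\ge c}}\mathbb{P}\left(\left\|R^{(m)}_{\alpha_{m,n}}\bar Y_n^{(m)}-K^+\hat y\right\|\ge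 C\right)=1 .$$ (b) If $\hat y=0$ and $\alpha_{m,n}$ is determined by the discrepancy principle described in the context with right-hand side $\kappa_{m,n}=\sqrt{\frac{m+\sqrt m}{n}}$, then there exists $p_\varepsilon>0$ such that for any $L>0$ $$\liminf_{\substack{m,n\to\infty\\ m/n\ge c}}\mathbb{P}\left(\left\|R^{(m)}_{\alpha_{m,n}}\bar Y_n^{(m)}-K^+\hat y\right\|\ge L\right)>p_\varepsilon .$$
   Context: $K^+$ is the Moore-Penrose inverse of $K$. $\bar Y^{(m)}_n=\frac1n\sum_{i=1}^n(Y_{i1},\dots,Y_{im})^T\in\mathbb{R}^m$. Spectral cut-off: $R^{(m)}_\alpha=F_\alpha\big((P_mK)^*P_mK\big)(P_mK)^*$ with $F_\alpha(\lambda)=1/\lambda$ for $\lambda\ge\alpha$ and $F_\alpha(\lambda)=0$ for $\lambda<\alpha$. Estimated noise level: $\delta^{est}_{m,n}=\sqrt{\frac mn s_{m,n}^2}$ with $s^2_{m,n}=\frac1m\sum_{j=1}^m\frac1{n-1}\sum_{i=1}^n\big(Y_{ij}-\frac1n\sum_{l=1}^nY_{lj}\big)^2$. Discrepancy principle with right-hand side $\kappa_{m,n}$: fix a ratio $\theta\in(0,1)$. Then $\alpha_{m,n}=\theta^k$, where $k\in\{0,1,2,\dots\}$ is the smallest index with $\|P_mKR^{(m)}_{\theta^k}\bar Y_n^{(m)}-\bar Y_n^{(m)}\|\le\kappa_{m,n}$. The limits are over $m,n\to\infty$ subject to $m/n\ge c$. *)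

theory Defs
  imports "HOL-Probability.Probability"
begin

section \<open>The Hilbert space of square-summable sequences\<close>

text \<open>Sequences are indexed by 1, 2, 3, ...; the entry with index 0 is fixed to be 0,
  so that all formulas keep the one-based indices.\<close>

typedef ell2 = "{x :: nat \<Rightarrow> real. x 0 = 0 \<and> summable (\<lambda>j. (x j)\<^sup>2)}"
  morphisms coord Abs_ell2
  by (rule exI[of _ "\<lambda>_. 0"]) simp

setup_lifting type_definition_ell2

lemma summable_mult_of_squares:
  fixes x y :: "nat \<Rightarrow> real"
  assumes "summable (\<lambda>j. (x j)\<^sup>2)" "summable (\<lambda>j. (y j)\<^sup>2)"
  shows "summable (\<lambda>j. x j * y j)"
proof (rule summable_comparison_test')
  show "summable (\<lambda>j. (x j)\<^sup>2 + (y j)\<^sup>2)"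
    using assms by (rule summable_add)
  show "norm (x j * y j) \<le> (x j)\<^sup>2 + (y j)\<^sup>2" if "j \<ge> 0" for j
  proof -
    have "2 * (\<bar>x j\<bar> * \<bar>y j\<bar>) \<le> (x j)\<^sup>2 + (y j)\<^sup>2"
      using sum_squares_bound[of "\<bar>x j\<bar>" "\<bar>y j\<bar>"] by (simp add: mult.assoc)
    moreover have "0 \<le> \<bar>x j\<bar> * \<bar>y j\<bar>" by simp
    ultimately show ?thesis by (simp only: real_norm_def abs_mult)
  qed
qed

lemma summable_coord_mult: "summable (\<lambda>j. coord x j * coord y j)"
  using coord[of x] coord[of y] by (intro summable_mult_of_squares) auto

instantiation ell2 :: real_inner
begin

lift_definition zero_ell2 :: ell2 is "\<lambda>_. 0" by simp

lift_definition uminus_ell2 :: "ell2 \<Rightarrow> ell2" is "\<lambda>x j. - x j" by simp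

lift_definition plus_ell2 :: "ell2 \<Rightarrow> ell2 \<Rightarrow> ell2" is "\<lambda>x y j. x j + y j"
proof safe
  fix x y :: "nat \<Rightarrow> real"
  assume "summable (\<lambda>j. (x j)\<^sup>2)" "summable (\<lambda>j. (y j)\<^sup>2)"
  then have "summable (\<lambda>j. (x j)\<^sup>2 + (y j)\<^sup>2 + 2 * (x j * y j))"
    by (intro summable_add summable_mult summable_mult_of_squares)
  then show "summable (\<lambda>j. (x j + y j)\<^sup>2)"
    by (simp add: power2_sum mult.assoc)
qed simp

lift_definition scaleR_ell2 :: "real \<Rightarrow> ell2 \<Rightarrow> ell2" is "\<lambda>r x j. r * x j"
  by (simp add: power_mult_distrib summable_mult)

definition minus_ell2 :: "ell2 \<Rightarrow> ell2 \<Rightarrow> ell2" where "x - y = x + - (y::ell2)"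

definition inner_ell2 :: "ell2 \<Rightarrow> ell2 \<Rightarrow> real"
  where "inner x y = (\<Sum>j. coord x j * coord y j)"

definition norm_ell2 :: "ell2 \<Rightarrow> real" where "norm (x::ell2) = sqrt (inner x x)"

definition dist_ell2 :: "ell2 \<Rightarrow> ell2 \<Rightarrow> real" where "dist x y = norm (x - y :: ell2)"

definition sgn_ell2 :: "ell2 \<Rightarrow> ell2" where "sgn x = scaleR (inverse (norm x)) (x::ell2)"

definition uniformity_ell2 :: "(ell2 \<times> ell2) filter"
  where "uniformity_ell2 = (INF e\<in>{0<..}. principal {(x, y). dist x y < e})"

definition open_ell2 :: "ell2 set \<Rightarrow> bool"
  where "open_ell2 U \<longleftrightarrow> (\<forall>x\<in>U. eventually (\<lambda>(x', y). x' = x \<longrightarrow> y \<in> U) uniformity)"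

instance
proof
  fix x y z :: ell2 and r s :: real
  show "x + y + z = x + (y + z)" "x + y = y + x" "0 + x = x" "- x + x = 0"
    "r *\<^sub>R (x + y) = r *\<^sub>R x + r *\<^sub>R y" "(r + s) *\<^sub>R x = r *\<^sub>R x + s *\<^sub>R x"
    "r *\<^sub>R s *\<^sub>R x = (r * s) *\<^sub>R x" "1 *\<^sub>R x = x"
    by (transfer; simp add: fun_eq_iff algebra_simps)+
  show "x - y = x + - y" by (rule minus_ell2_def)
  show "sgn x = scaleR (inverse (norm x)) x" by (rule sgn_ell2_def)
  show "dist x y = norm (x - y)" by (rule dist_ell2_def)
  show "uniformity = (INF e\<in>{0<..}. principal {(x::ell2, y). dist x y < e})"
    by (rule uniformity_ell2_def)
  show "open U \<longleftrightarrow> (\<forall>x\<in>U. \<forall>\<^sub>F (x', y) in uniformity. x' = x \<longrightarrow> y \<in> U)" for U :: "ell2 set"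
    by (rule open_ell2_def)
  show "inner x y = inner y x" by (simp add: inner_ell2_def mult.commute)
  show "inner (x + y) z = inner x z + inner y z"
    unfolding inner_ell2_def
    by (subst suminf_add) (auto intro: summable_coord_mult simp: plus_ell2.rep_eq distrib_right)
  show "inner (r *\<^sub>R x) y = r * inner x y"
    unfolding inner_ell2_def
    by (subst suminf_mult[symmetric])
      (auto intro: summable_coord_mult simp: scaleR_ell2.rep_eq mult.assoc)
  show "0 \<le> inner x x"
    unfolding inner_ell2_def by (intro suminf_nonneg summable_coord_mult) simp
  show "inner x x = 0 \<longleftrightarrow> x = 0"
  proof -
    have "inner x x = 0 \<longleftrightarrow> (\<forall>j. coord x j * coord x j = 0)"
      unfolding inner_ell2_def by (intro suminf_eq_zero_iff summable_coord_mult) simp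
    also have "\<dots> \<longleftrightarrow> x = 0"
      by transfer (auto simp: fun_eq_iff)
    finally show ?thesis .
  qed
  show "norm x = sqrt (inner x x)" by (rule norm_ell2_def)
qed

end

text \<open>The canonical orthonormal basis vectors \<open>v\<^sub>j\<close>, for \<open>j \<ge> 1\<close>.\<close>

lift_definition basis_vec :: "nat \<Rightarrow> ell2" is "\<lambda>j i. if i = j \<and> j \<noteq> 0 then 1 else 0"
proof safe
  fix j :: nat
  show "summable (\<lambda>i. (if i = j \<and> j \<noteq> 0 then 1 else 0 :: real)\<^sup>2)"
    by (rule summable_finite[of "{j}"]) auto
qed auto


section \<open>Operators\<close>

text \<open>Since the dimension \<open>m\<close> varies, a vector of \<open>\<real>\<^sup>m\<close> is a function on \<open>nat\<close> of which only
  the entries with indices \<open>1, ..., m\<close> are used; its Euclidean norm is \<open>L2_set y {1..m}\<close>.\<close>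

definition discretise :: "nat \<Rightarrow> ell2 \<Rightarrow> nat \<Rightarrow> real"  \<comment> \<open>the operator \<open>P\<^sub>m\<close>\<close>
  where "discretise m x l = (if l \<in> {1..m} then inner x (basis_vec l) else 0)"

definition adjoint_Rm :: "nat \<Rightarrow> (ell2 \<Rightarrow> nat \<Rightarrow> real) \<Rightarrow> (nat \<Rightarrow> real) \<Rightarrow> ell2"
  where "adjoint_Rm m A = (THE B. \<forall>x y. (\<Sum>l=1..m. A x l * y l) = inner x (B y))"

definition orth_proj :: "'a::real_inner set \<Rightarrow> 'a \<Rightarrow> 'a"
  where "orth_proj S x = (THE p. p \<in> S \<and> x - p \<in> orthogonal_comp S)"

text \<open>The functional calculus \<open>F(T)\<close> of a compact self-adjoint operator \<open>T\<close>: the sum of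
  \<open>F(\<mu>)\<close> times the orthogonal projection onto the eigenspace of \<open>\<mu>\<close>, over all
  eigenvalues \<open>\<mu>\<close> (including 0 if \<open>T\<close> has a kernel).\<close>

definition spectral_fun :: "(real \<Rightarrow> real) \<Rightarrow> ('a::real_inner \<Rightarrow> 'a) \<Rightarrow> 'a \<Rightarrow> 'a"
  where "spectral_fun F T x =
    (\<Sum>\<^sub>\<infinity>\<mu>\<in>{\<mu>. \<exists>v. v \<noteq> 0 \<and> T v = \<mu> *\<^sub>R v}. F \<mu> *\<^sub>R orth_proj {v. T v = \<mu> *\<^sub>R v} x)"

text \<open>The Moore-Penrose inverse is the linear extension of the inverse of
  \<open>K : N(K)\<^sup>\<bottom> \<rightarrow> R(K)\<close> to \<open>R(K) + R(K)\<^sup>\<bottom>\<close> that vanishes on \<open>R(K)\<^sup>\<bottom>\<close>; the value is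
  unspecified outside of \<open>R(K) + R(K)\<^sup>\<bottom>\<close>.\<close>

definition mp_inverse :: "('a::real_inner \<Rightarrow> 'b::real_inner) \<Rightarrow> 'b \<Rightarrow> 'a"
  where "mp_inverse K y =
    (THE x. x \<in> orthogonal_comp {z. K z = 0} \<and> y - K x \<in> orthogonal_comp (range K))"


section \<open>Spectral cut-off and the discrepancy principle\<close>

definition cutoff :: "real \<Rightarrow> real \<Rightarrow> real"
  where "cutoff \<alpha> \<mu> = (if \<mu> \<ge> \<alpha> then 1 / \<mu> else 0)"

definition spectral_cutoff :: "nat \<Rightarrow> (ell2 \<Rightarrow> ell2) \<Rightarrow> real \<Rightarrow> (nat \<Rightarrow> real) \<Rightarrow> ell2"
  where "spectral_cutoff m K \<alpha> y =
    (let A = (\<lambda>x. discretise m (K x)); A' = adjoint_Rm m A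
     in spectral_fun (cutoff \<alpha>) (\<lambda>x. A' (A x)) (A' y))"

definition discrepancy_alpha ::
    "nat \<Rightarrow> (ell2 \<Rightarrow> ell2) \<Rightarrow> real \<Rightarrow> real \<Rightarrow> (nat \<Rightarrow> real) \<Rightarrow> real"
  where "discrepancy_alpha m K \<theta> \<kappa> y =
    \<theta> ^ (LEAST k. L2_set (\<lambda>l. discretise m (K (spectral_cutoff m K (\<theta> ^ k) y)) l - y l) {1..m} \<le> \<kappa>)"


section \<open>Measurements\<close>

definition sample_mean :: "nat \<Rightarrow> (nat \<Rightarrow> nat \<Rightarrow> real) \<Rightarrow> nat \<Rightarrow> real"
  where "sample_mean n Y j = (\<Sum>i=1..n. Y i j) / real n"

definition sample_var :: "nat \<Rightarrow> nat \<Rightarrow> (nat \<Rightarrow> nat \<Rightarrow> real) \<Rightarrow> real"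
  where "sample_var m n Y =
    (\<Sum>j=1..m. (\<Sum>i=1..n. (Y i j - sample_mean n Y j)\<^sup>2) / (real n - 1)) / real m"

definition noise_level_est :: "nat \<Rightarrow> nat \<Rightarrow> (nat \<Rightarrow> nat \<Rightarrow> real) \<Rightarrow> real"
  where "noise_level_est m n Y = sqrt (real m / real n * sample_var m n Y)"

definition measurements ::
    "nat \<Rightarrow> ell2 \<Rightarrow> (nat \<Rightarrow> nat \<Rightarrow> 'a \<Rightarrow> real) \<Rightarrow> 'a \<Rightarrow> nat \<Rightarrow> nat \<Rightarrow> real"
  where "measurements m yhat \<delta> \<omega> i j = discretise m yhat j + \<delta> i j \<omega>"

definition noise_density :: "real \<Rightarrow> real \<Rightarrow> real"
  where "noise_density \<epsilon> x =
    (let c = \<epsilon> powr (1 + \<epsilon> / 2) / (2 * (2 + \<epsilon>) powr (\<epsilon> / 2)); b = sqrt (\<epsilon> / (2 + \<epsilon>))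
     in c / \<bar>x\<bar> powr (3 + \<epsilon>) * indicator ({..-b} \<union> {b..}) x)"

definition iid_noise :: "real \<Rightarrow> 'a measure \<Rightarrow> (nat \<Rightarrow> nat \<Rightarrow> 'a \<Rightarrow> real) \<Rightarrow> bool"
  where "iid_noise \<epsilon> M \<delta> \<longleftrightarrow>
    prob_space M \<and>
    prob_space.indep_vars M (\<lambda>_. borel) (\<lambda>(i, j). \<delta> i j) ({1..} \<times> {1..}) \<and>
    (\<forall>i\<ge>1. \<forall>j\<ge>1. distributed M lborel (\<delta> i j) (\<lambda>x. ennreal (noise_density \<epsilon> x)))"

definition diagonal_op :: "real \<Rightarrow> (ell2 \<Rightarrow> ell2) \<Rightarrow> bool"
  where "diagonal_op q K \<longleftrightarrow> bounded_linear K \<and>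
    (\<exists>\<sigma> :: nat \<Rightarrow> real. \<forall>j\<ge>1. (\<sigma> j)\<^sup>2 = real j powr (- q) \<and> K (basis_vec j) = \<sigma> j *\<^sub>R basis_vec j)"

text \<open>The filter on pairs \<open>(m, n)\<close> for \<open>m, n \<rightarrow> \<infinity>\<close> subject to \<open>m / n \<ge> c\<close>.\<close>

definition mn_filter :: "real \<Rightarrow> (nat \<times> nat) filter"
  where "mn_filter c =
    inf (sequentially \<times>\<^sub>F sequentially) (principal {(m, n). real m / real n \<ge> c})"

end

theory Submission
  imports Defs
begin

text \<open>In the singular basis everything is explicit: with \<open>S\<^sub>j = \<Sum>\<^sub>i \<delta>\<^sub>i\<^sub>j\<close> the squared residual of the
  cut-off at \<open>\<alpha>\<close> is the sum of \<open>(y\<^sub>j + S\<^sub>j/n)\<^sup>2\<close> over the components \<open>j \<le> m\<close> with \<open>\<sigma>\<^sub>j\<^sup>2 < \<alpha>\<close>. Split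
  \<open>\<Sum>\<^sub>j S\<^sub>j\<^sup>2 = T + U\<close> into the sum \<open>T\<close> of all \<open>\<delta>\<^sub>i\<^sub>j\<^sup>2\<close> and the cross terms \<open>U\<close>; the latter satisfy
  \<open>E U\<^sup>2 \<le> 2 m n\<^sup>2\<close> although the noise has only \<open>2 + \<epsilon>\<close> moments, while \<open>T \<ge> b\<^sup>2 m n\<close> since the noise is
  bounded away from 0.

  (a) The same \<open>T\<close> occurs in the residual and in the estimated noise level. Because \<open>\<tau> > 1\<close>, the
  threshold therefore exceeds the noise part of the residual by a fixed multiple of \<open>m/n \<ge> c\<close>, with
  probability tending to 1, and the iteration stops at an index bounded independently of \<open>m, n\<close>. A fixed
  component of the solution is then never reconstructed.

  (b) With positive probability a single large \<open>\<delta>\<^sub>i\<^sub>j\<close> lifts \<open>T\<close> above its mean by a multiple of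
  \<open>(mn)\<^bsup>2/(2+\<epsilon>)\<^esup>\<close>. For \<open>\<epsilon> < 2/3\<close> this dominates \<open>n \<surd>m\<close>, hence the slack in the threshold, the size of
  \<open>U\<close>, and also the loss from omitting the first \<open>2J\<close> columns with \<open>J \<approx> \<surd>m\<close>. The principle then does not
  stop before the components \<open>J < j \<le> 2J\<close> are included, and these alone amplify the noise to
  \<open>J\<^bsup>q+1\<^esup>/n \<ge> const J\<^bsup>q-1\<^esup>\<close>.\<close>

section \<open>The diagonal operator and its spectral cut-off\<close>

lemma coord_0 [simp]: "coord x 0 = 0"
  and summable_coord_sq: "summable (\<lambda>j. (coord x j)\<^sup>2)"
  using coord[of x] by auto

lemma ell2_eqI:
  assumes "\<And>j. j \<ge> 1 \<Longrightarrow> coord x j = coord y j"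
  shows "x = y"
proof -
  have "coord x j = coord y j" for j
    using assms[of j] by (cases "j = 0") auto
  then show ?thesis
    using coord_inject[of x y] by (simp add: fun_eq_iff)
qed

lemma coord_add [simp]: "coord (x + y) j = coord x j + coord y j"
  and coord_uminus [simp]: "coord (- x) j = - coord x j"
  and coord_scaleR [simp]: "coord (r *\<^sub>R x) j = r * coord x j"
  and coord_zero [simp]: "coord 0 j = 0"
  and coord_basis_vec: "coord (basis_vec l) j = (if j = l \<and> l \<noteq> 0 then 1 else 0)"
  by (simp_all add: plus_ell2.rep_eq uminus_ell2.rep_eq scaleR_ell2.rep_eq zero_ell2.rep_eq
      basis_vec.rep_eq)

lemma coord_diff [simp]: "coord (x - y) j = coord x j - coord y j"
  unfolding minus_ell2_def coord_add coord_uminus by simp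

lemma coord_sum [simp]: "coord (sum f A) j = (\<Sum>a\<in>A. coord (f a) j)"
  by (induction A rule: infinite_finite_induct) auto

lemma coord_sum_basis_vec:
  assumes "finite F" "0 \<notin> F"
  shows "coord (\<Sum>l\<in>F. f l *\<^sub>R basis_vec l) j = (if j \<in> F then f j else 0)"
proof -
  have "coord (\<Sum>l\<in>F. f l *\<^sub>R basis_vec l) j = (\<Sum>l\<in>F. if l = j then f l else 0)"
    using assms(2) by (auto simp: coord_basis_vec intro!: sum.cong)
  then show ?thesis using assms(1) by simp
qed

lemma inner_basis_vec [simp]: "inner x (basis_vec j) = coord x j"
proof -
  have "inner x (basis_vec j) = (\<Sum>i\<in>{j}. coord x i * coord (basis_vec j) i)"
    unfolding inner_ell2_def by (intro suminf_finite) (auto simp: coord_basis_vec)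
  also have "\<dots> = coord x j"
    by (cases "j = 0") (simp_all add: coord_basis_vec)
  finally show ?thesis .
qed

lemma inner_basis_vec_left [simp]: "inner (basis_vec j) x = coord x j"
  unfolding inner_commute[of "basis_vec j"] by (rule inner_basis_vec)

lemma bounded_linear_coord: "bounded_linear (\<lambda>x. coord x j)"
  unfolding inner_basis_vec[symmetric] by (rule bounded_linear_inner_left)

lemma norm_ell2_sq: "(norm x)\<^sup>2 = (\<Sum>j. (coord x j)\<^sup>2)"
  unfolding power2_norm_eq_inner inner_ell2_def by (simp add: power2_eq_square)

lemma abs_coord_le_norm: "\<bar>coord x j\<bar> \<le> norm x"
  by (rule power2_le_imp_le)
     (use sum_le_suminf[OF summable_coord_sq, of "{j}" x] in \<open>auto simp: norm_ell2_sq\<close>)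

lemma norm_ell2_sq_ge: "finite A \<Longrightarrow> (\<Sum>j\<in>A. (coord x j)\<^sup>2) \<le> (norm x)\<^sup>2"
  unfolding norm_ell2_sq by (intro sum_le_suminf summable_coord_sq) auto

text \<open>The squared distance from \<open>x\<close> to its partial sum over \<open>F\<close> is
  \<open>(norm x)\<^sup>2\<close> minus the squares collected in \<open>F\<close>, and these exhaust
  \<open>(norm x)\<^sup>2\<close>. The expansion lets a bounded operator be computed from its values
  on the basis.\<close>

lemma has_sum_basis_expansion: "((\<lambda>j. coord x j *\<^sub>R basis_vec j) has_sum x) {1..}"
proof -
  let ?s = "\<lambda>F. \<Sum>j\<in>F. coord x j *\<^sub>R basis_vec j"
  have "((\<lambda>j. (coord x j)\<^sup>2) has_sum (norm x)\<^sup>2) UNIV"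
    unfolding norm_ell2_sq
    by (intro sums_nonneg_imp_has_sum) (auto intro: summable_sums summable_coord_sq)
  then have "((\<lambda>j. (coord x j)\<^sup>2) has_sum (norm x)\<^sup>2) {1..}"
    by (rule has_sum_cong_neutral[THEN iffD1, rotated -1]) (auto simp: Suc_le_eq)
  then have "((\<lambda>F. \<Sum>j\<in>F. (coord x j)\<^sup>2) \<longlongrightarrow> (norm x)\<^sup>2) (finite_subsets_at_top {1..})"
    by (simp add: has_sum_def)
  then have lim: "((\<lambda>F. sqrt ((norm x)\<^sup>2 - (\<Sum>j\<in>F. (coord x j)\<^sup>2))) \<longlongrightarrow> sqrt ((norm x)\<^sup>2 - (norm x)\<^sup>2))
      (finite_subsets_at_top {1..})"
    by (intro tendsto_intros)
  have norm: "norm (?s F - x) = sqrt ((norm x)\<^sup>2 - (\<Sum>j\<in>F. (coord x j)\<^sup>2))"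
    if "finite F" "F \<subseteq> {1..}" for F
  proof -
    have c: "coord (?s F) j = (if j \<in> F then coord x j else 0)" for j
      using that by (subst coord_sum_basis_vec) auto
    have i: "inner (?s F) z = (\<Sum>j\<in>F. coord x j * coord z j)" for z
      by (simp add: inner_sum_left)
    have "(norm (?s F - x))\<^sup>2 = inner (?s F) (?s F) - 2 * inner (?s F) x + (norm x)\<^sup>2"
      by (simp add: power2_norm_eq_inner inner_diff inner_commute del: inner_basis_vec)
    also have "\<dots> = (norm x)\<^sup>2 - (\<Sum>j\<in>F. (coord x j)\<^sup>2)"
      unfolding i c by (simp add: power2_eq_square)
    finally show ?thesis
      by (rule real_sqrt_unique[symmetric]) simp
  qed
  have "((\<lambda>F. norm (?s F - x)) \<longlongrightarrow> 0) (finite_subsets_at_top {1..})"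
    using lim unfolding diff_self real_sqrt_zero
    by (rule Lim_transform_eventually)
       (auto intro!: eventually_finite_subsets_at_top_weakI simp: norm)
  then show ?thesis
    unfolding has_sum_def by (rule LIM_zero_cancel[OF tendsto_norm_zero_cancel])
qed

text \<open>The limit is written down directly as a sequence and then recognised by its own basis
  expansion, so completeness is never invoked. This decodes the exact data of claim (a).\<close>

lemma infsum_basis_vec:
  assumes "summable (\<lambda>j. (f j)\<^sup>2)" "j \<ge> 1"
  shows "coord (\<Sum>\<^sub>\<infinity>j\<in>{1..}. f j *\<^sub>R basis_vec j) j = f j"
proof -
  define x where "x = Abs_ell2 (\<lambda>j. if j = 0 then 0 else f j)"
  have "summable (\<lambda>j. (if j = 0 then 0 else f j)\<^sup>2)"
    by (rule summable_comparison_test'[OF assms(1)]) auto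
  then have c: "coord x j = (if j = 0 then 0 else f j)" for j
    unfolding x_def by (subst Abs_ell2_inverse) auto
  have "(\<Sum>\<^sub>\<infinity>j\<in>{1..}. f j *\<^sub>R basis_vec j) = (\<Sum>\<^sub>\<infinity>j\<in>{1..}. coord x j *\<^sub>R basis_vec j)"
    by (rule infsum_cong) (auto simp: c)
  also have "\<dots> = x"
    by (rule infsumI[OF has_sum_basis_expansion])
  finally show ?thesis using assms(2) by (simp add: c)
qed

section \<open>The diagonal operator in coordinates: adjoint, cut-off, residual, inverse\<close>

locale diagonal =
  fixes q :: real and K :: "ell2 \<Rightarrow> ell2" and \<sigma> :: "nat \<Rightarrow> real"
  assumes q: "q > 0" and bl: "bounded_linear K"
    and \<sigma>: "\<And>j. j \<ge> 1 \<Longrightarrow> (\<sigma> j)\<^sup>2 = real j powr (- q)"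
    and K: "\<And>j. j \<ge> 1 \<Longrightarrow> K (basis_vec j) = \<sigma> j *\<^sub>R basis_vec j"
begin

lemma \<sigma>_nz: "j \<ge> 1 \<Longrightarrow> \<sigma> j \<noteq> 0"
  using \<sigma>[of j] by auto

text \<open>Injectivity of \<open>j powr (- q)\<close> for \<open>q > 0\<close>; it makes the
  nonzero eigenvalues of the discretised normal operator simple.\<close>

lemma \<sigma>_inj:
  assumes "l \<ge> 1" "j \<ge> 1" "(\<sigma> l)\<^sup>2 = (\<sigma> j)\<^sup>2"
  shows "l = j"
proof -
  have "(real l powr (- q)) powr (- (1 / q)) = (real j powr (- q)) powr (- (1 / q))"
    using assms \<sigma> by metis
  then show ?thesis
    using assms(1,2) q by (simp add: powr_powr)
qed

text \<open>Continuity carries the action on basis vectors over to the whole expansion of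
  \<open>x\<close>, of which a single term has a nonzero coordinate \<open>j\<close>.\<close>

lemma coord_K: assumes "j \<ge> 1" shows "coord (K x) j = \<sigma> j * coord x j"
proof -
  interpret L: bounded_linear "\<lambda>x. coord (K x) j"
    by (rule bounded_linear_compose[OF bounded_linear_coord bl])
  have "((\<lambda>i. coord (K (coord x i *\<^sub>R basis_vec i)) j) has_sum coord (K x) j) {1..}"
    by (rule has_sum_bounded_linear[OF L.bounded_linear_axioms has_sum_basis_expansion])
  moreover have "((\<lambda>i. coord (K (coord x i *\<^sub>R basis_vec i)) j) has_sum
      (\<Sum>i\<in>{j}. coord (K (coord x i *\<^sub>R basis_vec i)) j)) {1..}"
    using assms by (intro has_sum_finite_neutralI[of "{j}"]) (auto simp: L.scale K coord_basis_vec)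
  ultimately have "coord (K x) j = coord (K (coord x j *\<^sub>R basis_vec j)) j"
    by (auto dest: has_sum_unique)
  then show ?thesis
    using assms by (simp add: L.scale K coord_basis_vec)
qed

lemma discretise_K: "discretise m (K x) l = (if l \<in> {1..m} then \<sigma> l * coord x l else 0)"
  by (simp add: discretise_def coord_K)

lemma adjoint_K:
  "adjoint_Rm m (\<lambda>x. discretise m (K x)) = (\<lambda>y. \<Sum>l=1..m. (\<sigma> l * y l) *\<^sub>R basis_vec l)"
  unfolding adjoint_Rm_def
proof (rule the_equality)
  show *: "\<forall>x y. (\<Sum>l = 1..m. discretise m (K x) l * y l)
      = inner x (\<Sum>l=1..m. (\<sigma> l * y l) *\<^sub>R basis_vec l)"
    by (auto simp: discretise_K inner_sum_right intro!: sum.cong)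
  fix B assume B: "\<forall>x y. (\<Sum>l = 1..m. discretise m (K x) l * y l) = inner x (B y)"
  show "B = (\<lambda>y. \<Sum>l=1..m. (\<sigma> l * y l) *\<^sub>R basis_vec l)"
    using B * by (metis (no_types, lifting) ext vector_eq_ldot)
qed

lemma coord_normal_op:
  "coord (adjoint_Rm m (\<lambda>x. discretise m (K x)) (discretise m (K x))) j =
    (if j \<in> {1..m} then (\<sigma> j)\<^sup>2 * coord x j else 0)"
  by (auto simp: adjoint_K coord_sum_basis_vec discretise_K power2_eq_square simp del: coord_sum)

text \<open>The eigenvalue is nonzero, which excludes all coordinates beyond \<open>m\<close>, and
  differs from the other squared singular values. The eigenspace is therefore the line spanned by
  \<open>basis_vec l\<close>.\<close>

lemma orth_proj_eigenspace:
  fixes m defines "T \<equiv> \<lambda>x. adjoint_Rm m (\<lambda>x. discretise m (K x)) (discretise m (K x))"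
  assumes l: "l \<in> {1..m}"
  shows "orth_proj {v. T v = (\<sigma> l)\<^sup>2 *\<^sub>R v} x = coord x l *\<^sub>R basis_vec l"
proof -
  have coord_T: "coord (T x) j = (if j \<in> {1..m} then (\<sigma> j)\<^sup>2 * coord x j else 0)" for x j
    unfolding T_def by (rule coord_normal_op)
  have eig: "{v. T v = (\<sigma> l)\<^sup>2 *\<^sub>R v} = range (\<lambda>r. r *\<^sub>R basis_vec l)"
  proof safe
    fix v assume v: "T v = (\<sigma> l)\<^sup>2 *\<^sub>R v"
    have "coord v j = 0" if "j \<ge> 1" "j \<noteq> l" for j
    proof (rule ccontr)
      assume nz: "coord v j \<noteq> 0"
      have "(if j \<in> {1..m} then (\<sigma> j)\<^sup>2 * coord v j else 0) = (\<sigma> l)\<^sup>2 * coord v j"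
        using arg_cong[OF v, of "\<lambda>u. coord u j"] by (simp only: coord_T coord_scaleR)
      then show False
        using nz \<sigma>_inj[of j l] \<sigma>_nz[of l] that l by (auto split: if_splits)
    qed
    then have "v = coord v l *\<^sub>R basis_vec l"
      by (intro ell2_eqI) (auto simp: coord_basis_vec)
    then show "v \<in> range (\<lambda>r. r *\<^sub>R basis_vec l)" by blast
  next
    fix r show "T (r *\<^sub>R basis_vec l) = (\<sigma> l)\<^sup>2 *\<^sub>R r *\<^sub>R basis_vec l"
      using l by (intro ell2_eqI) (auto simp: coord_T coord_basis_vec)
  qed
  show ?thesis
    unfolding orth_proj_def eig
  proof (rule the_equality)
    show "coord x l *\<^sub>R basis_vec l \<in> range (\<lambda>r. r *\<^sub>R basis_vec l) \<and>
        x - coord x l *\<^sub>R basis_vec l \<in> orthogonal_comp (range (\<lambda>r. r *\<^sub>R basis_vec l))"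
      using l by (auto simp: orthogonal_comp_def orthogonal_def inner_diff
          coord_basis_vec)
    fix p assume "p \<in> range (\<lambda>r. r *\<^sub>R basis_vec l) \<and>
        x - p \<in> orthogonal_comp (range (\<lambda>r. r *\<^sub>R basis_vec l))"
    then obtain r where p: "p = r *\<^sub>R basis_vec l"
      and "orthogonal (1 *\<^sub>R basis_vec l) (x - p)"
      unfolding orthogonal_comp_def by blast
    then have "coord x l = r"
      using l by (simp add: orthogonal_def coord_basis_vec)
    with p show "p = coord x l *\<^sub>R basis_vec l" by simp
  qed
qed

text \<open>Every eigenvalue is either 0 or one of the \<open>(\<sigma> l)\<^sup>2\<close> with
  \<open>l \<le> m\<close>. The kernel contributes nothing because
  \<open>cutoff \<alpha> 0 = 0\<close> for positive \<open>\<alpha>\<close>, so the infinite sum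
  over the spectrum collapses to a finite sum, reindexed through the simplicity of the
  eigenvalues.\<close>

lemma spectral_cutoff_eq:
  assumes "\<alpha> > 0"
  shows "spectral_cutoff m K \<alpha> y =
    (\<Sum>l\<in>{l\<in>{1..m}. real l powr (- q) \<ge> \<alpha>}. (y l / \<sigma> l) *\<^sub>R basis_vec l)"
proof -
  define T where "T x = adjoint_Rm m (\<lambda>x. discretise m (K x)) (discretise m (K x))" for x
  define z where "z = adjoint_Rm m (\<lambda>x. discretise m (K x)) y"
  define G where "G \<mu> = cutoff \<alpha> \<mu> *\<^sub>R orth_proj {v. T v = \<mu> *\<^sub>R v} z" for \<mu>
  have coord_T: "coord (T x) j = (if j \<in> {1..m} then (\<sigma> j)\<^sup>2 * coord x j else 0)" for x j
    unfolding T_def by (rule coord_normal_op)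
  have z: "coord z j = (if j \<in> {1..m} then \<sigma> j * y j else 0)" for j
    by (auto simp: z_def adjoint_K coord_sum_basis_vec simp del: coord_sum)
  have "spectral_cutoff m K \<alpha> y = infsum G {\<mu>. \<exists>v. v \<noteq> 0 \<and> T v = \<mu> *\<^sub>R v}"
    unfolding spectral_cutoff_def spectral_fun_def Let_def T_def G_def z_def ..
  also have "\<dots> = infsum G ((\<lambda>l. (\<sigma> l)\<^sup>2) ` {1..m})"
  proof (rule infsum_cong_neutral)
    fix \<mu> assume "\<mu> \<in> {\<mu>. \<exists>v. v \<noteq> 0 \<and> T v = \<mu> *\<^sub>R v} - (\<lambda>l. (\<sigma> l)\<^sup>2) ` {1..m}"
    then obtain v where v: "v \<noteq> 0" "T v = \<mu> *\<^sub>R v" and \<mu>: "\<mu> \<notin> (\<lambda>l. (\<sigma> l)\<^sup>2) ` {1..m}"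
      by blast
    have "\<mu> = 0"
    proof (rule ccontr)
      assume "\<mu> \<noteq> 0"
      have "coord v j = 0" for j
      proof -
        have "(if j \<in> {1..m} then (\<sigma> j)\<^sup>2 * coord v j else 0) = \<mu> * coord v j"
          using arg_cong[OF v(2), of "\<lambda>u. coord u j"] by (simp only: coord_T coord_scaleR)
        with \<mu> \<open>\<mu> \<noteq> 0\<close> show ?thesis by (auto split: if_splits)
      qed
      with v(1) show False by (auto intro: ell2_eqI)
    qed
    then show "G \<mu> = 0"
      using assms by (simp add: G_def cutoff_def)
  next
    fix \<mu> assume "\<mu> \<in> (\<lambda>l. (\<sigma> l)\<^sup>2) ` {1..m} - {\<mu>. \<exists>v. v \<noteq> 0 \<and> T v = \<mu> *\<^sub>R v}"
    then obtain l where l: "l \<in> {1..m}" and \<mu>: "\<mu> = (\<sigma> l)\<^sup>2"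
      and no: "\<nexists>v. v \<noteq> 0 \<and> T v = \<mu> *\<^sub>R v"
      by blast
    have "T (basis_vec l) = \<mu> *\<^sub>R basis_vec l"
      using l by (intro ell2_eqI) (auto simp: coord_T coord_basis_vec \<mu>)
    moreover have "basis_vec l \<noteq> 0"
      using l coord_basis_vec[of l l] by auto
    ultimately show "G \<mu> = 0" using no by blast
  qed simp
  also have "\<dots> = (\<Sum>l=1..m. G ((\<sigma> l)\<^sup>2))"
  proof -
    have "inj_on (\<lambda>l. (\<sigma> l)\<^sup>2) {1..m}"
      by (intro inj_onI, rule \<sigma>_inj) auto
    then show ?thesis by (simp add: sum.reindex)
  qed
  also have "\<dots> = (\<Sum>l=1..m. if real l powr (- q) \<ge> \<alpha> then (y l / \<sigma> l) *\<^sub>R basis_vec l else 0)"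
  proof (rule sum.cong)
    fix l assume l: "l \<in> {1..m}"
    have "G ((\<sigma> l)\<^sup>2) = cutoff \<alpha> ((\<sigma> l)\<^sup>2) *\<^sub>R (\<sigma> l * y l) *\<^sub>R basis_vec l"
      unfolding G_def T_def orth_proj_eigenspace[OF l] z using l by simp
    also have "\<dots> = (if real l powr (- q) \<ge> \<alpha> then (y l / \<sigma> l) *\<^sub>R basis_vec l else 0)"
      using l \<sigma>_nz[of l] by (auto simp: cutoff_def \<sigma>[symmetric] power2_eq_square)
    finally show "G ((\<sigma> l)\<^sup>2) = \<dots>" .
  qed simp
  also have "\<dots> = (\<Sum>l\<in>{l\<in>{1..m}. real l powr (- q) \<ge> \<alpha>}. (y l / \<sigma> l) *\<^sub>R basis_vec l)"
    by (rule sum.inter_filter[symmetric]) simp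
  finally show ?thesis .
qed

lemma coord_spectral_cutoff:
  assumes "\<alpha> > 0"
  shows "coord (spectral_cutoff m K \<alpha> y) l =
    (if l \<in> {1..m} \<and> real l powr (- q) \<ge> \<alpha> then y l / \<sigma> l else 0)"
  unfolding spectral_cutoff_eq[OF assms]
  by (subst coord_sum_basis_vec) simp_all

text \<open>On a reconstructed component \<open>K\<close> undoes the division by
  \<open>\<sigma> l\<close> exactly, so the residual consists of the data that were cut off.\<close>

lemma residual_eq:
  assumes "\<alpha> > 0"
  shows "L2_set (\<lambda>l. discretise m (K (spectral_cutoff m K \<alpha> y)) l - y l) {1..m} =
    sqrt (\<Sum>l\<in>{l\<in>{1..m}. real l powr (- q) < \<alpha>}. (y l)\<^sup>2)"
proof -
  have "(\<Sum>l\<in>{1..m}. (discretise m (K (spectral_cutoff m K \<alpha> y)) l - y l)\<^sup>2) =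
    (\<Sum>l\<in>{1..m}. if real l powr (- q) < \<alpha> then (y l)\<^sup>2 else 0)"
    using \<sigma>_nz by (intro sum.cong) (auto simp: discretise_K coord_spectral_cutoff[OF assms])
  also have "\<dots> = (\<Sum>l\<in>{l\<in>{1..m}. real l powr (- q) < \<alpha>}. (y l)\<^sup>2)"
    by (rule sum.inter_filter[symmetric]) simp
  finally show ?thesis
    unfolding L2_set_def by (rule arg_cong)
qed

text \<open>\<open>K\<close> is injective, so the first defining condition holds for every vector.
  As \<open>K x = y\<close>, existence is clear; testing \<open>y - K x'\<close> against the images
  of the basis vectors gives uniqueness.\<close>

lemma coord_mp_inverse:
  assumes x: "\<And>j. j \<ge> 1 \<Longrightarrow> \<sigma> j * coord x j = coord y j"
  shows "mp_inverse K y = x"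
  unfolding mp_inverse_def
proof (rule the_equality)
  have ker: "{z. K z = 0} = {0}"
  proof safe
    fix z assume "K z = 0"
    then have "\<sigma> j * coord z j = 0" if "j \<ge> 1" for j
      using coord_K[OF that, of z] by simp
    then show "z = 0" using \<sigma>_nz by (intro ell2_eqI) auto
  qed (simp add: linear_0 bounded_linear.linear[OF bl])
  have eq: "K x = y"
    by (rule ell2_eqI) (simp add: coord_K x)
  show "x \<in> orthogonal_comp {z. K z = 0} \<and> y - K x \<in> orthogonal_comp (range K)"
    by (simp add: ker eq orthogonal_comp_def orthogonal_def)
  fix x' assume "x' \<in> orthogonal_comp {z. K z = 0} \<and> y - K x' \<in> orthogonal_comp (range K)"
  then have o: "inner (y - K x') (K (basis_vec j)) = 0" for j
    by (auto simp: orthogonal_comp_def orthogonal_def inner_commute)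
  show "x' = x"
  proof (rule ell2_eqI)
    fix j :: nat assume j: "j \<ge> 1"
    have "\<sigma> j * coord (y - K x') j = 0"
      using o[of j] j by (simp add: K)
    then show "coord x' j = coord x j"
      using j \<sigma>_nz[of j] x[of j, symmetric] by (simp add: coord_K)
  qed
qed

end

section \<open>Second moments of sums of independent variables\<close>

lemma (in prob_space) integrable_mult_of_squares:
  fixes f g :: "'a \<Rightarrow> real"
  assumes [measurable]: "f \<in> borel_measurable M" "g \<in> borel_measurable M"
    and "integrable M (\<lambda>x. (f x)\<^sup>2)" "integrable M (\<lambda>x. (g x)\<^sup>2)"
  shows "integrable M (\<lambda>x. f x * g x)"
proof (rule Bochner_Integration.integrable_bound)
  show "integrable M (\<lambda>x. (f x)\<^sup>2 + (g x)\<^sup>2)"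
    using assms by simp
  show "AE x in M. norm (f x * g x) \<le> norm ((f x)\<^sup>2 + (g x)\<^sup>2)"
  proof (rule AE_I2)
    fix x
    have "2 * (\<bar>f x\<bar> * \<bar>g x\<bar>) \<le> (f x)\<^sup>2 + (g x)\<^sup>2"
      using sum_squares_bound[of "\<bar>f x\<bar>" "\<bar>g x\<bar>"] by (simp add: mult.assoc)
    moreover have "0 \<le> \<bar>f x\<bar> * \<bar>g x\<bar>" by simp
    ultimately show "norm (f x * g x) \<le> norm ((f x)\<^sup>2 + (g x)\<^sup>2)"
      unfolding real_norm_def abs_mult by linarith
  qed
qed simp

lemma (in prob_space) expectation_sum_square_orthogonal:
  fixes f :: "'i \<Rightarrow> 'a \<Rightarrow> real"
  assumes I: "finite I"
    and meas: "\<And>i. i \<in> I \<Longrightarrow> f i \<in> borel_measurable M"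
    and int: "\<And>i. i \<in> I \<Longrightarrow> integrable M (\<lambda>x. (f i x)\<^sup>2)"
    and orth: "\<And>i j. i \<in> I \<Longrightarrow> j \<in> I \<Longrightarrow> i \<noteq> j \<Longrightarrow> expectation (\<lambda>x. f i x * f j x) = 0"
  shows "integrable M (\<lambda>x. (\<Sum>i\<in>I. f i x)\<^sup>2)"
    and "expectation (\<lambda>x. (\<Sum>i\<in>I. f i x)\<^sup>2) = (\<Sum>i\<in>I. expectation (\<lambda>x. (f i x)\<^sup>2))"
proof -
  have int': "integrable M (\<lambda>x. f i x * f j x)" if "i \<in> I" "j \<in> I" for i j
    using that by (intro integrable_mult_of_squares meas int)
  have eq: "(\<lambda>x. (\<Sum>i\<in>I. f i x)\<^sup>2) = (\<lambda>x. \<Sum>i\<in>I. \<Sum>j\<in>I. f i x * f j x)"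
    by (simp add: power2_eq_square sum_product)
  show "integrable M (\<lambda>x. (\<Sum>i\<in>I. f i x)\<^sup>2)"
    unfolding eq by (intro Bochner_Integration.integrable_sum int')
  have "expectation (\<lambda>x. (\<Sum>i\<in>I. f i x)\<^sup>2) = (\<Sum>i\<in>I. \<Sum>j\<in>I. expectation (\<lambda>x. f i x * f j x))"
    unfolding eq by (simp add: Bochner_Integration.integral_sum int')
  also have "\<dots> = (\<Sum>i\<in>I. \<Sum>j\<in>I. if j = i then expectation (\<lambda>x. (f i x)\<^sup>2) else 0)"
    by (intro sum.cong) (auto simp: orth power2_eq_square)
  also have "\<dots> = (\<Sum>i\<in>I. expectation (\<lambda>x. (f i x)\<^sup>2))"
    using I by (simp add: sum.delta)
  finally show "expectation (\<lambda>x. (\<Sum>i\<in>I. f i x)\<^sup>2) = (\<Sum>i\<in>I. expectation (\<lambda>x. (f i x)\<^sup>2))" .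
qed

lemma (in prob_space) indep_vars_imp_indep_var:
  assumes "indep_vars (\<lambda>_. N) X I" "i \<in> I" "j \<in> I" "i \<noteq> j"
  shows "indep_var N (X i) N (X j)"
proof -
  have "indep_var N ((\<lambda>f. f i) \<circ> (\<lambda>\<omega>. restrict (\<lambda>i. X i \<omega>) {i}))
      N ((\<lambda>f. f j) \<circ> (\<lambda>\<omega>. restrict (\<lambda>i. X i \<omega>) {j}))"
    using assms by (intro indep_var_compose[OF indep_var_restrict[OF assms(1)]]) auto
  then show ?thesis by (simp add: o_def)
qed

lemma (in prob_space) indep_vars_expectation_sum_square:
  fixes X :: "'i \<Rightarrow> 'a \<Rightarrow> real"
  assumes I: "finite I" and ind: "indep_vars (\<lambda>_. borel) X I"
    and int: "\<And>i. i \<in> I \<Longrightarrow> integrable M (\<lambda>x. (X i x)\<^sup>2)"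
    and mean: "\<And>i. i \<in> I \<Longrightarrow> expectation (X i) = 0"
  shows "integrable M (\<lambda>x. (\<Sum>i\<in>I. X i x)\<^sup>2)"
    and "expectation (\<lambda>x. (\<Sum>i\<in>I. X i x)\<^sup>2) = (\<Sum>i\<in>I. expectation (\<lambda>x. (X i x)\<^sup>2))"
proof -
  have meas: "X i \<in> borel_measurable M" if "i \<in> I" for i
    using ind that by (simp add: indep_vars_def)
  have "expectation (\<lambda>x. X i x * X j x) = 0" if "i \<in> I" "j \<in> I" "i \<noteq> j" for i j
    using that by (subst indep_var_lebesgue_integral)
      (auto simp: mean intro!: indep_vars_imp_indep_var[OF ind] square_integrable_imp_integrable meas int)
  from expectation_sum_square_orthogonal[OF I meas int this]
  show "integrable M (\<lambda>x. (\<Sum>i\<in>I. X i x)\<^sup>2)"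
    and "expectation (\<lambda>x. (\<Sum>i\<in>I. X i x)\<^sup>2) = (\<Sum>i\<in>I. expectation (\<lambda>x. (X i x)\<^sup>2))"
    by auto
qed

text \<open>The noise has no fourth moment, so a squared column sum has no variance; after removing the
  diagonal terms it has one.\<close>

definition offdiag :: "'i set \<Rightarrow> ('i \<Rightarrow> real) \<Rightarrow> real"
  where "offdiag I x = (\<Sum>i\<in>I. x i)\<^sup>2 - (\<Sum>i\<in>I. (x i)\<^sup>2)"

lemma offdiag_insert:
  assumes "finite I" "k \<notin> I"
  shows "offdiag (insert k I) x = offdiag I x + 2 * (x k * (\<Sum>i\<in>I. x i))"
  using assms by (simp add: offdiag_def power2_sum algebra_simps)

text \<open>Induction on \<open>I\<close>. A new variable adds twice its product with the old sum;
  this increment has mean 0, is uncorrelated with the old value and has second moment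
  \<open>4 * card I\<close>. Only second moments of the individual variables enter, and
  \<open>2 * N^2 + 4 * N \<le> 2 * (N + 1)^2\<close> closes the induction.\<close>

lemma (in prob_space) offdiag_moments:
  fixes X :: "'i \<Rightarrow> 'a \<Rightarrow> real"
  assumes "finite I" "indep_vars (\<lambda>_. borel) X I"
    and "\<And>i. i \<in> I \<Longrightarrow> integrable M (\<lambda>x. (X i x)\<^sup>2)"
    and "\<And>i. i \<in> I \<Longrightarrow> expectation (X i) = 0"
    and "\<And>i. i \<in> I \<Longrightarrow> expectation (\<lambda>x. (X i x)\<^sup>2) = 1"
  shows "integrable M (\<lambda>\<omega>. (offdiag I (\<lambda>i. X i \<omega>))\<^sup>2) \<and>
    expectation (\<lambda>\<omega>. offdiag I (\<lambda>i. X i \<omega>)) = 0 \<and>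
    expectation (\<lambda>\<omega>. (offdiag I (\<lambda>i. X i \<omega>))\<^sup>2) \<le> 2 * (real (card I))\<^sup>2"
  using assms
proof (induction I rule: finite_induct)
  case empty
  then show ?case by (simp add: offdiag_def)
next
  case (insert k I)
  define S where "S \<omega> = (\<Sum>i\<in>I. X i \<omega>)" for \<omega>
  define W where "W \<omega> = offdiag I (\<lambda>i. X i \<omega>)" for \<omega>
  have ind: "indep_vars (\<lambda>_. borel) X I"
    using insert.prems(1) by (rule indep_vars_subset) auto
  have Xm [measurable]: "X i \<in> borel_measurable M" if "i \<in> insert k I" for i
    using insert.prems(1) that by (auto simp: indep_vars_def)
  have [measurable]: "X k \<in> borel_measurable M" by (rule Xm) simp
  have [measurable]: "S \<in> borel_measurable M" "W \<in> borel_measurable M"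
    unfolding S_def[abs_def] W_def[abs_def] offdiag_def by (measurable; simp add: Xm)+
  have IH: "integrable M (\<lambda>\<omega>. (W \<omega>)\<^sup>2)" "expectation W = 0"
      "expectation (\<lambda>\<omega>. (W \<omega>)\<^sup>2) \<le> 2 * (real (card I))\<^sup>2"
    using insert.IH[OF ind] insert.prems by (auto simp: W_def[abs_def])
  have S2: "integrable M (\<lambda>\<omega>. (S \<omega>)\<^sup>2)" "expectation (\<lambda>\<omega>. (S \<omega>)\<^sup>2) = real (card I)"
    using indep_vars_expectation_sum_square[OF insert.hyps(1) ind] insert.prems by (auto simp: S_def)
  have Xk: "integrable M (\<lambda>\<omega>. (X k \<omega>)\<^sup>2)" "expectation (X k) = 0" "expectation (\<lambda>\<omega>. (X k \<omega>)\<^sup>2) = 1"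
    using insert.prems by auto
  have indS: "indep_var borel (X k) borel S"
    unfolding S_def by (rule indep_vars_sum[OF insert.hyps insert.prems(1)])
  \<comment> \<open>\<open>S\<close> and \<open>W\<close> are dependent, but both are functions of
    the variables in \<open>I\<close>, so their product is independent of the new variable. This
    annihilates the mixed term when the square is expanded.\<close>
  have indSW: "indep_var borel (X k) borel (\<lambda>\<omega>. S \<omega> * W \<omega>)"
  proof -
    have "indep_var borel ((\<lambda>f. f k) \<circ> (\<lambda>\<omega>. restrict (\<lambda>i. X i \<omega>) {k}))
        borel ((\<lambda>f. (\<Sum>i\<in>I. f i) * offdiag I f) \<circ> (\<lambda>\<omega>. restrict (\<lambda>i. X i \<omega>) I))"
      using insert.hyps unfolding offdiag_def
      by (intro indep_var_compose[OF indep_var_restrict[OF insert.prems(1)]]) auto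
    then show ?thesis
      by (simp add: o_def S_def W_def offdiag_def cong: sum.cong)
  qed
  have iXk: "integrable M (X k)"
    by (rule square_integrable_imp_integrable) (auto simp: Xk)
  have iS: "integrable M S"
    by (rule square_integrable_imp_integrable) (auto simp: S2)
  have iW: "integrable M W"
    by (rule square_integrable_imp_integrable) (auto simp: IH)
  have iSW: "integrable M (\<lambda>\<omega>. S \<omega> * W \<omega>)"
    by (intro integrable_mult_of_squares S2 IH) auto
  have XS: "integrable M (\<lambda>\<omega>. X k \<omega> * S \<omega>)" "expectation (\<lambda>\<omega>. X k \<omega> * S \<omega>) = 0"
    using indep_var_integrable[OF indS iXk iS] indep_var_lebesgue_integral[OF indS iXk iS] Xk by auto
  have XSW: "integrable M (\<lambda>\<omega>. X k \<omega> * (S \<omega> * W \<omega>))" "expectation (\<lambda>\<omega>. X k \<omega> * (S \<omega> * W \<omega>)) = 0"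
    using indep_var_integrable[OF indSW iXk iSW] indep_var_lebesgue_integral[OF indSW iXk iSW] Xk by auto
  have ind2: "indep_var borel (\<lambda>\<omega>. (X k \<omega>)\<^sup>2) borel (\<lambda>\<omega>. (S \<omega>)\<^sup>2)"
    using indep_var_compose[OF indS, of "\<lambda>x. x\<^sup>2" borel "\<lambda>x. x\<^sup>2" borel] by (simp add: o_def)
  have X2S2: "integrable M (\<lambda>\<omega>. (X k \<omega>)\<^sup>2 * (S \<omega>)\<^sup>2)"
      "expectation (\<lambda>\<omega>. (X k \<omega>)\<^sup>2 * (S \<omega>)\<^sup>2) = real (card I)"
    using indep_var_integrable[OF ind2 Xk(1) S2(1)] indep_var_lebesgue_integral[OF ind2 Xk(1) S2(1)]
      Xk S2 by auto
  have eq: "offdiag (insert k I) (\<lambda>i. X i \<omega>) = W \<omega> + 2 * (X k \<omega> * S \<omega>)" for \<omega>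
    using insert.hyps by (simp add: offdiag_insert W_def S_def)
  have eq2: "(W \<omega> + 2 * (X k \<omega> * S \<omega>))\<^sup>2 =
      (W \<omega>)\<^sup>2 + 4 * (X k \<omega> * (S \<omega> * W \<omega>)) + 4 * ((X k \<omega>)\<^sup>2 * (S \<omega>)\<^sup>2)" for \<omega>
    by (simp add: power2_eq_square algebra_simps)
  have "expectation (\<lambda>\<omega>. W \<omega> + 2 * (X k \<omega> * S \<omega>)) = 0"
    using XS iW IH by simp
  moreover have "integrable M (\<lambda>\<omega>. (W \<omega> + 2 * (X k \<omega> * S \<omega>))\<^sup>2)"
    unfolding eq2 using IH XSW X2S2 by simp
  moreover have "expectation (\<lambda>\<omega>. (W \<omega> + 2 * (X k \<omega> * S \<omega>))\<^sup>2) =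
      expectation (\<lambda>\<omega>. (W \<omega>)\<^sup>2) + 4 * real (card I)"
    unfolding eq2 using IH XSW X2S2 by simp
  moreover have "2 * (real (card I))\<^sup>2 + 4 * real (card I) \<le> 2 * (real (card (insert k I)))\<^sup>2"
    using insert.hyps by (simp add: power2_eq_square algebra_simps)
  ultimately show ?case
    unfolding eq using IH(3) by auto
qed

text \<open>Different columns are functions of disjoint blocks of variables, hence independent;
  being centred, their second moments add up.\<close>

lemma (in prob_space) offdiag_columns_moments:
  fixes X :: "'i \<times> 'j \<Rightarrow> 'a \<Rightarrow> real"
  assumes I: "finite I" and L: "finite L" and ind: "indep_vars (\<lambda>_. borel) X (I \<times> L)"
    and int: "\<And>p. p \<in> I \<times> L \<Longrightarrow> integrable M (\<lambda>x. (X p x)\<^sup>2)"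
    and mean: "\<And>p. p \<in> I \<times> L \<Longrightarrow> expectation (X p) = 0"
    and var: "\<And>p. p \<in> I \<times> L \<Longrightarrow> expectation (\<lambda>x. (X p x)\<^sup>2) = 1"
  defines "U \<equiv> \<lambda>\<omega>. \<Sum>j\<in>L. offdiag I (\<lambda>i. X (i, j) \<omega>)"
  shows "integrable M (\<lambda>\<omega>. (U \<omega>)\<^sup>2)"
    and "expectation (\<lambda>\<omega>. (U \<omega>)\<^sup>2) \<le> 2 * real (card L) * (real (card I))\<^sup>2"
proof -
  define W where "W j \<omega> = offdiag I (\<lambda>i. X (i, j) \<omega>)" for j \<omega>
  have mom: "integrable M (\<lambda>\<omega>. (W j \<omega>)\<^sup>2) \<and> expectation (W j) = 0 \<and>
      expectation (\<lambda>\<omega>. (W j \<omega>)\<^sup>2) \<le> 2 * (real (card I))\<^sup>2" if j: "j \<in> L" for j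
  proof -
    have "indep_vars (\<lambda>_. borel) (\<lambda>i. X (i, j)) I"
    proof -
      \<comment> \<open>A change of index from the pair to its first entry, obtained by grouping the
        family into blocks of one element each.\<close>
      have "indep_vars (\<lambda>i. PiM {(i, j)} (\<lambda>_. borel)) (\<lambda>i \<omega>. restrict (\<lambda>p. X p \<omega>) {(i, j)}) I"
        using j by (intro indep_vars_restrict[OF ind]) (auto simp: disjoint_family_on_def)
      from indep_vars_compose2[OF this, of "\<lambda>i f. f (i, j)" "\<lambda>_. borel"] show ?thesis
        by simp
    qed
    then show ?thesis
      unfolding W_def using j by (intro offdiag_moments I) (auto simp: int mean var)
  qed
  have indW: "indep_vars (\<lambda>_. borel) W L"
  proof -
    have "indep_vars (\<lambda>j. PiM (I \<times> {j}) (\<lambda>_. borel)) (\<lambda>j \<omega>. restrict (\<lambda>p. X p \<omega>) (I \<times> {j})) L"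
      by (intro indep_vars_restrict[OF ind]) (auto simp: disjoint_family_on_def)
    moreover have "(\<lambda>f. offdiag I (\<lambda>i. f (i, j))) \<in> borel_measurable (PiM (I \<times> {j}) (\<lambda>_. borel))" for j
      unfolding offdiag_def
      by (intro borel_measurable_diff borel_measurable_power borel_measurable_sum measurable_component_singleton)
        auto
    ultimately have "indep_vars (\<lambda>_. borel)
        (\<lambda>j \<omega>. offdiag I (\<lambda>i. restrict (\<lambda>p. X p \<omega>) (I \<times> {j}) (i, j))) L"
      by (rule indep_vars_compose2)
    then show ?thesis
      by (simp add: W_def[abs_def] offdiag_def cong: sum.cong)
  qed
  have U: "U = (\<lambda>\<omega>. \<Sum>j\<in>L. W j \<omega>)"
    by (simp add: U_def W_def)
  show "integrable M (\<lambda>\<omega>. (U \<omega>)\<^sup>2)"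
    unfolding U using mom by (intro indep_vars_expectation_sum_square L indW) auto
  have "expectation (\<lambda>\<omega>. (U \<omega>)\<^sup>2) = (\<Sum>j\<in>L. expectation (\<lambda>\<omega>. (W j \<omega>)\<^sup>2))"
    unfolding U using mom by (intro indep_vars_expectation_sum_square L indW) auto
  also have "\<dots> \<le> (\<Sum>j\<in>L. 2 * (real (card I))\<^sup>2)"
    using mom by (intro sum_mono) auto
  finally show "expectation (\<lambda>\<omega>. (U \<omega>)\<^sup>2) \<le> 2 * real (card L) * (real (card I))\<^sup>2"
    by (simp add: mult_ac)
qed

section \<open>Moments of the noise\<close>

lemma nn_integral_powr_tail:
  fixes s H :: real
  assumes "H > 0" "s > 1"
  shows "(\<integral>\<^sup>+x. ennreal (x powr (- s)) * indicator {H..} x \<partial>lborel) = ennreal (H powr (1 - s) / (s - 1))"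
proof -
  have "(\<integral>\<^sup>+x. ennreal (x powr (- s)) * indicator {H..} x \<partial>lborel) =
      ennreal (0 - H powr (1 - s) / (1 - s))"
  proof (rule nn_integral_FTC_atLeast)
    fix x assume "H \<le> x"
    then show "((\<lambda>x. x powr (1 - s) / (1 - s)) has_real_derivative x powr (- s)) (at x)"
      using assms DERIV_cdivide[OF has_real_derivative_powr[of x "1 - s"], of "1 - s"] by simp
  next
    have "((\<lambda>x. x powr (1 - s)) \<longlongrightarrow> 0) at_top"
      using assms by (intro tendsto_neg_powr filterlim_ident) auto
    from tendsto_divide[OF this tendsto_const[of "1 - s"]]
    show "((\<lambda>x. x powr (1 - s) / (1 - s)) \<longlongrightarrow> 0) at_top"
      using assms by simp
  qed auto
  also have "0 - H powr (1 - s) / (1 - s) = H powr (1 - s) / (s - 1)"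
    using minus_divide_right[of "H powr (1 - s)" "1 - s"] by simp
  finally show ?thesis .
qed

lemma nn_integral_powr_Icc:
  fixes s a H :: real
  assumes "0 < a" "a \<le> H" "s > -1"
  shows "(\<integral>\<^sup>+x. ennreal (x powr s) * indicator {a..H} x \<partial>lborel) \<le> ennreal (H powr (1 + s) / (1 + s))"
proof -
  have "(\<integral>\<^sup>+x. ennreal (x powr s) * indicator {a..H} x \<partial>lborel) =
      ennreal (H powr (1 + s) / (1 + s) - a powr (1 + s) / (1 + s))"
  proof (rule nn_integral_FTC_Icc)
    fix x assume "x \<in> {a..H}"
    then show "((\<lambda>x. x powr (1 + s) / (1 + s)) has_real_derivative x powr s) (at x)"
      using assms DERIV_cdivide[OF has_real_derivative_powr[of x "1 + s"], of "1 + s"] by simp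
  qed (use assms in auto)
  also have "\<dots> \<le> ennreal (H powr (1 + s) / (1 + s))"
    using assms by (intro ennreal_leI) simp
  finally show ?thesis .
qed

lemma nn_integral_even:
  fixes g :: "real \<Rightarrow> ennreal"
  assumes [measurable]: "g \<in> borel_measurable borel" and A[measurable]: "A \<in> sets borel"
    and pos: "A \<subseteq> {0<..}"
  shows "(\<integral>\<^sup>+x. g \<bar>x\<bar> * indicator A \<bar>x\<bar> \<partial>lborel) = 2 * (\<integral>\<^sup>+x. g x * indicator A x \<partial>lborel)"
proof -
  have "(\<integral>\<^sup>+x. g \<bar>x\<bar> * indicator A \<bar>x\<bar> \<partial>lborel) =
      (\<integral>\<^sup>+x. g x * indicator A x + g (- x) * indicator A (- x) \<partial>lborel)"
  proof (intro nn_integral_cong)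
    fix x :: real
    have "x \<notin> A \<or> - x \<notin> A" using pos by (cases "x > 0") auto
    moreover have "0 \<notin> A" using pos by auto
    ultimately show "g \<bar>x\<bar> * indicator A \<bar>x\<bar> = g x * indicator A x + g (- x) * indicator A (- x)"
      using pos by (cases "x \<ge> 0") (auto simp: indicator_def)
  qed
  also have "\<dots> = (\<integral>\<^sup>+x. g x * indicator A x \<partial>lborel) + (\<integral>\<^sup>+x. g (- x) * indicator A (- x) \<partial>lborel)"
    by (rule nn_integral_add) auto
  also have "(\<integral>\<^sup>+x. g (- x) * indicator A (- x) \<partial>lborel) = (\<integral>\<^sup>+x. g x * indicator A x \<partial>lborel)"
    using nn_integral_real_affine[of "\<lambda>x. g x * indicator A x" "-1" 0] by simp
  finally show ?thesis by (simp add: mult_2)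
qed

section \<open>The noise density and its partial moments\<close>

definition noise_scale :: "real \<Rightarrow> real"
  where "noise_scale \<epsilon> = sqrt (\<epsilon> / (2 + \<epsilon>))"

lemma noise_scale_pos: "\<epsilon> > 0 \<Longrightarrow> noise_scale \<epsilon> > 0"
  by (simp add: noise_scale_def)

lemma noise_scale_sq: "\<epsilon> > 0 \<Longrightarrow> (noise_scale \<epsilon>)\<^sup>2 = \<epsilon> / (2 + \<epsilon>)"
  by (simp add: noise_scale_def)

text \<open>Expressing the normalising constant through the threshold \<open>b\<close> exhibits an
  even Pareto density; the moments below then become powers of \<open>b / H\<close>.\<close>

lemma noise_density_eq:
  assumes "\<epsilon> > 0"
  shows "noise_density \<epsilon> x = \<epsilon> / 2 * noise_scale \<epsilon> powr \<epsilon> * \<bar>x\<bar> powr (- (3 + \<epsilon>)) *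
    indicator {noise_scale \<epsilon>..} \<bar>x\<bar>"
proof -
  have c: "\<epsilon> powr (1 + \<epsilon> / 2) / (2 * (2 + \<epsilon>) powr (\<epsilon> / 2)) = \<epsilon> / 2 * noise_scale \<epsilon> powr \<epsilon>"
    using assms unfolding noise_scale_def
    by (simp add: powr_half_sqrt[symmetric] powr_powr powr_divide powr_add)
  have i: "indicator ({..- noise_scale \<epsilon>} \<union> {noise_scale \<epsilon>..}) x =
      (indicator {noise_scale \<epsilon>..} \<bar>x\<bar> :: real)"
    using noise_scale_pos[OF assms] by (auto simp: indicator_def)
  show ?thesis
    unfolding noise_density_def Let_def noise_scale_def[symmetric] c i powr_minus_divide by simp
qed

lemma noise_density_nonneg: "\<epsilon> > 0 \<Longrightarrow> noise_density \<epsilon> x \<ge> 0"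
  by (simp add: noise_density_eq)

lemma noise_density_measurable [measurable]: "noise_density \<epsilon> \<in> borel_measurable borel"
  unfolding noise_density_def Let_def by measurable

lemma ennreal_mult_twice:
  "0 \<le> x \<Longrightarrow> 0 \<le> y \<Longrightarrow> ennreal x * (ennreal 2 * ennreal y) = ennreal (x * (2 * y))"
  by (simp only: ennreal_mult[symmetric] mult_nonneg_nonneg zero_le_numeral)

text \<open>One formula for two uses: \<open>r = 0\<close> gives tail probabilities and
  \<open>r = 2\<close> tail second moments. The bound on \<open>r\<close> is convergence at
  infinity.\<close>

lemma nn_integral_noise_tail:
  assumes \<epsilon>: "\<epsilon> > 0" and r: "r < 2 + \<epsilon>" and H: "noise_scale \<epsilon> \<le> H"
  shows "(\<integral>\<^sup>+x. ennreal (noise_density \<epsilon> x) * (ennreal (\<bar>x\<bar> powr r) * indicator {H..} \<bar>x\<bar>) \<partial>lborel) =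
    ennreal (\<epsilon> * noise_scale \<epsilon> powr \<epsilon> * H powr (r - 2 - \<epsilon>) / (2 + \<epsilon> - r))"
proof -
  let ?c = "\<epsilon> / 2 * noise_scale \<epsilon> powr \<epsilon>"
  have H0: "H > 0" using noise_scale_pos[OF \<epsilon>] H by linarith
  have "(\<integral>\<^sup>+x. ennreal (noise_density \<epsilon> x) * (ennreal (\<bar>x\<bar> powr r) * indicator {H..} \<bar>x\<bar>) \<partial>lborel) =
      (\<integral>\<^sup>+x. ennreal ?c * (ennreal (\<bar>x\<bar> powr (- (3 + \<epsilon> - r))) * indicator {H..} \<bar>x\<bar>) \<partial>lborel)"
  proof (intro nn_integral_cong)
    fix x :: real
    have "\<bar>x\<bar> powr (- (3 + \<epsilon>)) * \<bar>x\<bar> powr r = \<bar>x\<bar> powr (- (3 + \<epsilon> - r))"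
      by (simp add: powr_add[symmetric] algebra_simps)
    then show "ennreal (noise_density \<epsilon> x) * (ennreal (\<bar>x\<bar> powr r) * indicator {H..} \<bar>x\<bar>) =
        ennreal ?c * (ennreal (\<bar>x\<bar> powr (- (3 + \<epsilon> - r))) * indicator {H..} \<bar>x\<bar>)"
      using \<epsilon> H by (auto simp: noise_density_eq ennreal_mult[symmetric] mult.assoc split: split_indicator)
  qed
  also have "\<dots> = ennreal ?c * (2 * (\<integral>\<^sup>+x. ennreal (x powr (- (3 + \<epsilon> - r))) * indicator {H..} x \<partial>lborel))"
    using H0 by (subst nn_integral_cmult) (auto intro!: arg_cong2[where f = "(*)"] nn_integral_even)
  also have "\<dots> = ennreal ?c * (ennreal 2 * ennreal (H powr (1 - (3 + \<epsilon> - r)) / (3 + \<epsilon> - r - 1)))"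
    using H0 r by (subst nn_integral_powr_tail) auto
  also have "\<dots> = ennreal (?c * (2 * (H powr (1 - (3 + \<epsilon> - r)) / (3 + \<epsilon> - r - 1))))"
    using \<epsilon> r by (intro ennreal_mult_twice) auto
  also have "?c * (2 * (H powr (1 - (3 + \<epsilon> - r)) / (3 + \<epsilon> - r - 1))) =
      \<epsilon> * noise_scale \<epsilon> powr \<epsilon> * H powr (r - 2 - \<epsilon>) / (2 + \<epsilon> - r)"
    by (simp add: algebra_simps)
  finally show ?thesis .
qed

text \<open>After multiplication by the density the integrand is a multiple of
  \<open>\<bar>x\<bar> powr (1 - \<epsilon>)\<close>. For \<open>\<epsilon> < 2\<close> its
  antiderivative is a positive power, so dropping the lower endpoint leaves an upper bound.\<close>

lemma nn_integral_noise_fourth: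
  assumes \<epsilon>: "\<epsilon> > 0" "\<epsilon> < 2" and H: "noise_scale \<epsilon> \<le> H"
  shows "(\<integral>\<^sup>+x. ennreal (noise_density \<epsilon> x) * (ennreal (x ^ 4) * indicator {..<H} \<bar>x\<bar>) \<partial>lborel) \<le>
    ennreal (\<epsilon> * noise_scale \<epsilon> powr \<epsilon> * H powr (2 - \<epsilon>) / (2 - \<epsilon>))"
proof -
  let ?c = "\<epsilon> / 2 * noise_scale \<epsilon> powr \<epsilon>"
  have b: "noise_scale \<epsilon> > 0" by (rule noise_scale_pos[OF \<epsilon>(1)])
  have "(\<integral>\<^sup>+x. ennreal (noise_density \<epsilon> x) * (ennreal (x ^ 4) * indicator {..<H} \<bar>x\<bar>) \<partial>lborel) \<le>
      (\<integral>\<^sup>+x. ennreal ?c * (ennreal (\<bar>x\<bar> powr (1 - \<epsilon>)) * indicator {noise_scale \<epsilon>..H} \<bar>x\<bar>) \<partial>lborel)"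
  proof (intro nn_integral_mono)
    fix x :: real
    have "\<bar>x\<bar> powr (- (3 + \<epsilon>)) * x ^ 4 = \<bar>x\<bar> powr (1 - \<epsilon>)" if "x \<noteq> 0"
    proof -
      have "x ^ 4 = \<bar>x\<bar> powr 4" using that by simp
      then show ?thesis by (simp only: powr_add[symmetric]) simp
    qed
    then show "ennreal (noise_density \<epsilon> x) * (ennreal (x ^ 4) * indicator {..<H} \<bar>x\<bar>) \<le>
        ennreal ?c * (ennreal (\<bar>x\<bar> powr (1 - \<epsilon>)) * indicator {noise_scale \<epsilon>..H} \<bar>x\<bar>)"
      using \<epsilon> b by (cases "x = 0")
        (auto simp: noise_density_eq ennreal_mult[symmetric] mult.assoc split: split_indicator)
  qed
  also have "\<dots> = ennreal ?c * (2 * (\<integral>\<^sup>+x. ennreal (x powr (1 - \<epsilon>)) * indicator {noise_scale \<epsilon>..H} x \<partial>lborel))"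
    using b by (subst nn_integral_cmult) (auto intro!: arg_cong2[where f = "(*)"] nn_integral_even)
  also have "\<dots> \<le> ennreal ?c * (ennreal 2 * ennreal (H powr (1 + (1 - \<epsilon>)) / (1 + (1 - \<epsilon>))))"
    using b \<epsilon> H nn_integral_powr_Icc[of "noise_scale \<epsilon>" H "1 - \<epsilon>"] by (auto intro!: mult_left_mono)
  also have "\<dots> = ennreal (?c * (2 * (H powr (1 + (1 - \<epsilon>)) / (1 + (1 - \<epsilon>)))))"
    using \<epsilon> by (intro ennreal_mult_twice) auto
  also have "?c * (2 * (H powr (1 + (1 - \<epsilon>)) / (1 + (1 - \<epsilon>)))) =
      \<epsilon> * noise_scale \<epsilon> powr \<epsilon> * H powr (2 - \<epsilon>) / (2 - \<epsilon>)"
    by (simp add: algebra_simps)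
  finally show ?thesis .
qed

section \<open>Tail probabilities and truncated moments of the noise variables\<close>

locale noise = prob_space M for M :: "'a measure" +
  fixes \<epsilon> :: real and X :: "nat \<times> nat \<Rightarrow> 'a \<Rightarrow> real"
  assumes \<epsilon>: "0 < \<epsilon>" "\<epsilon> < 2"
    and ind: "indep_vars (\<lambda>_. borel) X ({1..} \<times> {1..})"
    and dist: "\<And>p. p \<in> {1..} \<times> {1..} \<Longrightarrow> distributed M lborel (X p) (\<lambda>x. ennreal (noise_density \<epsilon> x))"
begin

abbreviation b where "b \<equiv> noise_scale \<epsilon>"

lemma b_pos: "b > 0"
  by (rule noise_scale_pos[OF \<epsilon>(1)])

context
  fixes p :: "nat \<times> nat" assumes p: "p \<in> {1..} \<times> {1..}"
begin

lemma meas: "X p \<in> borel_measurable M"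
  using distributed_measurable[OF dist[OF p]] by simp

text \<open>The factor \<open>\<epsilon> / (2 + \<epsilon>)\<close> left over by the integration is
  exactly \<open>b\<^sup>2\<close>, which completes the power of \<open>b\<close>.\<close>

lemma prob_ge:
  assumes "H \<ge> b"
  shows "prob {\<omega>\<in>space M. H \<le> \<bar>X p \<omega>\<bar>} = (b / H) powr (2 + \<epsilon>)"
proof -
  have H: "H > 0" using b_pos assms by linarith
  have "emeasure M (X p -` {x. H \<le> \<bar>x\<bar>} \<inter> space M) =
      (\<integral>\<^sup>+x. ennreal (noise_density \<epsilon> x) * indicator {x. H \<le> \<bar>x\<bar>} x \<partial>lborel)"
    by (rule distributed_emeasure[OF dist[OF p]]) simp
  also have "\<dots> = (\<integral>\<^sup>+x. ennreal (noise_density \<epsilon> x) * (ennreal (\<bar>x\<bar> powr 0) * indicator {H..} \<bar>x\<bar>) \<partial>lborel)"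
    using H by (intro nn_integral_cong) (auto split: split_indicator)
  also have "\<dots> = ennreal (\<epsilon> * b powr \<epsilon> * H powr (0 - 2 - \<epsilon>) / (2 + \<epsilon> - 0))"
    using \<epsilon> assms by (intro nn_integral_noise_tail) auto
  also have "\<epsilon> * b powr \<epsilon> * H powr (0 - 2 - \<epsilon>) / (2 + \<epsilon> - 0) = b\<^sup>2 * b powr \<epsilon> * H powr (- (2 + \<epsilon>))"
    using \<epsilon> by (simp add: noise_scale_sq)
  also have "b\<^sup>2 = b powr 2" using b_pos by simp
  also have "b powr 2 * b powr \<epsilon> * H powr (- (2 + \<epsilon>)) = (b / H) powr (2 + \<epsilon>)"
    using b_pos H unfolding powr_minus_divide powr_add[symmetric] by (simp add: powr_divide)
  finally show ?thesis
    by (simp add: measure_def vimage_def Int_def conj_commute)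
qed

lemma tail_second_moment:
  assumes "H \<ge> b"
  shows "integrable M (\<lambda>\<omega>. (X p \<omega>)\<^sup>2 * indicator {H..} \<bar>X p \<omega>\<bar>)"
    and "expectation (\<lambda>\<omega>. (X p \<omega>)\<^sup>2 * indicator {H..} \<bar>X p \<omega>\<bar>) = (b / H) powr \<epsilon>"
proof -
  note [measurable] = meas
  have H: "H > 0" using b_pos assms by linarith
  have "(\<integral>\<^sup>+\<omega>. ennreal ((X p \<omega>)\<^sup>2 * indicator {H..} \<bar>X p \<omega>\<bar>) \<partial>M) =
      (\<integral>\<^sup>+x. ennreal (noise_density \<epsilon> x) * ennreal (x\<^sup>2 * indicator {H..} \<bar>x\<bar>) \<partial>lborel)"
    by (rule distributed_nn_integral[OF dist[OF p], symmetric]) simp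
  also have "\<dots> = (\<integral>\<^sup>+x. ennreal (noise_density \<epsilon> x) * (ennreal (\<bar>x\<bar> powr 2) * indicator {H..} \<bar>x\<bar>) \<partial>lborel)"
    using H by (intro nn_integral_cong) (auto split: split_indicator)
  also have "\<dots> = ennreal (\<epsilon> * b powr \<epsilon> * H powr (2 - 2 - \<epsilon>) / (2 + \<epsilon> - 2))"
    using \<epsilon> assms by (intro nn_integral_noise_tail) auto
  also have "\<epsilon> * b powr \<epsilon> * H powr (2 - 2 - \<epsilon>) / (2 + \<epsilon> - 2) = (b / H) powr \<epsilon>"
    using \<epsilon> b_pos H by (simp add: powr_divide powr_minus divide_simps)
  finally show "integrable M (\<lambda>\<omega>. (X p \<omega>)\<^sup>2 * indicator {H..} \<bar>X p \<omega>\<bar>)"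
    and "expectation (\<lambda>\<omega>. (X p \<omega>)\<^sup>2 * indicator {H..} \<bar>X p \<omega>\<bar>) = (b / H) powr \<epsilon>"
    by (subst (asm) nn_integral_eq_integrable; simp)+
qed

lemma AE_ge: "AE \<omega> in M. b \<le> \<bar>X p \<omega>\<bar>"
proof -
  note [measurable] = meas
  have "prob {\<omega>\<in>space M. b \<le> \<bar>X p \<omega>\<bar>} = 1"
    using b_pos by (subst prob_ge) auto
  from AE_prob_1[OF this] show ?thesis by simp
qed

text \<open>Almost surely \<open>\<bar>X p\<bar> \<ge> b\<close>, so the tail second moment at
  \<open>H = b\<close> is already the full one.\<close>

lemma second_moment:
  shows "integrable M (\<lambda>\<omega>. (X p \<omega>)\<^sup>2)" and "expectation (\<lambda>\<omega>. (X p \<omega>)\<^sup>2) = 1"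
proof -
  note [measurable] = meas
  have AE: "AE \<omega> in M. (X p \<omega>)\<^sup>2 * indicator {b..} \<bar>X p \<omega>\<bar> = (X p \<omega>)\<^sup>2"
    using AE_ge by eventually_elim simp
  show "integrable M (\<lambda>\<omega>. (X p \<omega>)\<^sup>2)"
    by (rule integrable_cong_AE_imp[OF tail_second_moment(1)[OF order_refl]]) (use AE in auto)
  have "expectation (\<lambda>\<omega>. (X p \<omega>)\<^sup>2) = expectation (\<lambda>\<omega>. (X p \<omega>)\<^sup>2 * indicator {b..} \<bar>X p \<omega>\<bar>)"
    by (rule integral_cong_AE) (use AE in auto)
  then show "expectation (\<lambda>\<omega>. (X p \<omega>)\<^sup>2) = 1"
    using tail_second_moment(2)[OF order_refl] b_pos by simp
qed

text \<open>The density is even, so reflection turns the integral into its own negative.\<close>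

lemma mean: "expectation (X p) = 0"
proof -
  have "expectation (X p) = (\<integral>x. noise_density \<epsilon> x * x \<partial>lborel)"
    by (rule distributed_integral[OF dist[OF p], symmetric]) (auto simp: noise_density_nonneg \<epsilon>)
  moreover have "(\<integral>x. noise_density \<epsilon> x * x \<partial>lborel) = - (\<integral>x. noise_density \<epsilon> x * x \<partial>lborel)"
    using lborel_integral_real_affine[of "-1" "\<lambda>x. noise_density \<epsilon> x * x" 0]
    by (simp add: noise_density_eq \<epsilon>)
  ultimately show ?thesis by simp
qed

lemma truncated_second_moment:
  assumes "H \<ge> b"
  shows "integrable M (\<lambda>\<omega>. (X p \<omega>)\<^sup>2 * indicator {..<H} \<bar>X p \<omega>\<bar>)"
    and "expectation (\<lambda>\<omega>. (X p \<omega>)\<^sup>2 * indicator {..<H} \<bar>X p \<omega>\<bar>) = 1 - (b / H) powr \<epsilon>"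
proof -
  have eq: "(\<lambda>\<omega>. (X p \<omega>)\<^sup>2 * indicator {..<H} \<bar>X p \<omega>\<bar>) =
      (\<lambda>\<omega>. (X p \<omega>)\<^sup>2 - (X p \<omega>)\<^sup>2 * indicator {H..} \<bar>X p \<omega>\<bar>)"
    by (auto split: split_indicator)
  show "integrable M (\<lambda>\<omega>. (X p \<omega>)\<^sup>2 * indicator {..<H} \<bar>X p \<omega>\<bar>)"
    unfolding eq by (intro Bochner_Integration.integrable_diff second_moment tail_second_moment assms)
  show "expectation (\<lambda>\<omega>. (X p \<omega>)\<^sup>2 * indicator {..<H} \<bar>X p \<omega>\<bar>) = 1 - (b / H) powr \<epsilon>"
    unfolding eq using second_moment tail_second_moment[OF assms] by simp
qed

lemma truncated_fourth_moment:
  assumes "H \<ge> b"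
  shows "integrable M (\<lambda>\<omega>. ((X p \<omega>)\<^sup>2 * indicator {..<H} \<bar>X p \<omega>\<bar>)\<^sup>2)"
    and "expectation (\<lambda>\<omega>. ((X p \<omega>)\<^sup>2 * indicator {..<H} \<bar>X p \<omega>\<bar>)\<^sup>2) \<le>
      \<epsilon> * b powr \<epsilon> / (2 - \<epsilon>) * H powr (2 - \<epsilon>)"
proof -
  note [measurable] = meas
  let ?f = "\<lambda>\<omega>. ((X p \<omega>)\<^sup>2 * indicator {..<H} \<bar>X p \<omega>\<bar>)\<^sup>2"
  let ?B = "\<epsilon> * b powr \<epsilon> * H powr (2 - \<epsilon>) / (2 - \<epsilon>)"
  have "(\<integral>\<^sup>+\<omega>. ennreal (?f \<omega>) \<partial>M) =
      (\<integral>\<^sup>+x. ennreal (noise_density \<epsilon> x) * ennreal ((x\<^sup>2 * indicator {..<H} \<bar>x\<bar>)\<^sup>2) \<partial>lborel)"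
    by (rule distributed_nn_integral[OF dist[OF p], symmetric]) simp
  also have "\<dots> = (\<integral>\<^sup>+x. ennreal (noise_density \<epsilon> x) * (ennreal (x ^ 4) * indicator {..<H} \<bar>x\<bar>) \<partial>lborel)"
    by (intro nn_integral_cong) (auto split: split_indicator)
  also have "\<dots> \<le> ennreal ?B"
    using \<epsilon> assms by (intro nn_integral_noise_fourth) auto
  finally have le: "(\<integral>\<^sup>+\<omega>. ennreal (?f \<omega>) \<partial>M) \<le> ennreal ?B" .
  then show int: "integrable M ?f"
    by (intro integrableI_bounded) (auto simp: le_less_trans[OF le])
  have "ennreal (expectation ?f) \<le> ennreal ?B"
    using le by (subst nn_integral_eq_integral[symmetric]) (auto simp: int)
  then show "expectation ?f \<le> \<epsilon> * b powr \<epsilon> / (2 - \<epsilon>) * H powr (2 - \<epsilon>)"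
    using \<epsilon> by (subst (asm) ennreal_le_iff) auto
qed

end

end

section \<open>The effect of one large observation\<close>

context noise
begin

text \<open>By independence, with \<open>\<pi>\<close> the probability of a single jump, no jump
  occurs with probability \<open>(1 - \<pi>) ^ N \<le> exp (- N * \<pi>)\<close>; for
  \<open>N * \<pi> \<le> 1\<close> this stays below \<open>1 - N * \<pi> / 2\<close>.\<close>

lemma prob_jump:
  fixes I :: "(nat \<times> nat) set"
  assumes I: "finite I" "I \<noteq> {}" "I \<subseteq> {1..} \<times> {1..}" and H: "H \<ge> b"
    and le: "real (card I) * (b / H) powr (2 + \<epsilon>) \<le> 1"
  shows "prob {\<omega>\<in>space M. \<exists>p\<in>I. H \<le> \<bar>X p \<omega>\<bar>} \<ge> real (card I) * (b / H) powr (2 + \<epsilon>) / 2"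
proof -
  let ?\<pi> = "(b / H) powr (2 + \<epsilon>)" and ?N = "real (card I)"
  have mX: "X p \<in> borel_measurable M" if "p \<in> I" for p
    using that I by (intro meas) auto
  have ev: "{\<omega>\<in>space M. H \<le> \<bar>X p \<omega>\<bar>} \<in> events" if "p \<in> I" for p
  proof -
    have [measurable]: "X p \<in> borel_measurable M" by (rule mX[OF that])
    show ?thesis by measurable
  qed
  have ev': "{\<omega>\<in>space M. \<exists>p\<in>I. H \<le> \<bar>X p \<omega>\<bar>} \<in> events"
    using I(1) ev by (rule sets.sets_Collect_finite_Ex[rotated])
  have single: "prob (X p -` {x. \<bar>x\<bar> < H} \<inter> space M) = 1 - ?\<pi>" if "p \<in> I" for p
  proof -
    have "X p -` {x. \<bar>x\<bar> < H} \<inter> space M = space M - {\<omega>\<in>space M. H \<le> \<bar>X p \<omega>\<bar>}"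
      by auto
    then show ?thesis
      using prob_compl[OF ev[OF that]] prob_ge[of p H] that I(3) H by auto
  qed
  have "space M - {\<omega>\<in>space M. \<exists>p\<in>I. H \<le> \<bar>X p \<omega>\<bar>} =
      (\<Inter>p\<in>I. X p -` {x. \<bar>x\<bar> < H} \<inter> space M)"
    using I(2) by (auto simp: not_le[symmetric])
  then have "prob (space M - {\<omega>\<in>space M. \<exists>p\<in>I. H \<le> \<bar>X p \<omega>\<bar>}) =
      prob (\<Inter>p\<in>I. X p -` {x. \<bar>x\<bar> < H} \<inter> space M)" by (rule arg_cong)
  also have "\<dots> = (\<Prod>p\<in>I. prob (X p -` {x. \<bar>x\<bar> < H} \<inter> space M))"
    using I by (intro indep_varsD[OF ind]) auto
  also have "\<dots> = (1 - ?\<pi>) ^ card I"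
    by (simp only: single prod_constant cong: prod.cong)
  also have "\<dots> \<le> exp (- (?N * ?\<pi>))"
  proof -
    have "1 - ?\<pi> \<ge> 0"
      using single[symmetric] I(2) by (metis ex_in_conv measure_nonneg)
    then have "(1 - ?\<pi>) ^ card I \<le> exp (- ?\<pi>) ^ card I"
      using exp_ge_add_one_self[of "- ?\<pi>"] by (intro power_mono) auto
    then show ?thesis by (simp add: exp_of_nat_mult[symmetric])
  qed
  \<comment> \<open>With \<open>u = N * \<pi>\<close> in the unit interval,
    \<open>(1 - u / 2) * (1 + u) \<ge> 1\<close>, and \<open>1 + u \<le> exp u\<close>.\<close>
  also have "exp (- (?N * ?\<pi>)) \<le> 1 - ?N * ?\<pi> / 2"
  proof -
    have "1 \<le> (1 - ?N * ?\<pi> / 2) * (1 + ?N * ?\<pi>)"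
      using le mult_left_mono[OF le, of "?N * ?\<pi>"] by (simp add: algebra_simps)
    also have "\<dots> \<le> (1 - ?N * ?\<pi> / 2) * exp (?N * ?\<pi>)"
      using le by (intro mult_left_mono exp_ge_add_one_self) auto
    finally show ?thesis by (simp add: exp_minus field_simps)
  qed
  finally show ?thesis using prob_compl[OF ev'] by simp
qed

text \<open>Chebyshev's inequality: truncated squares have a variance, bounded by the truncated
  fourth moment, whereas the full squares need not have one.\<close>

lemma prob_truncated_sum:
  fixes I :: "(nat \<times> nat) set"
  assumes I: "finite I" "I \<subseteq> {1..} \<times> {1..}" and H: "H \<ge> b" and s: "s > 0"
  shows "prob {\<omega>\<in>space M. (\<Sum>p\<in>I. (X p \<omega>)\<^sup>2 * indicator {..<H} \<bar>X p \<omega>\<bar>) \<le>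
      real (card I) * (1 - (b / H) powr \<epsilon>) - s} \<le>
    real (card I) * (\<epsilon> * b powr \<epsilon> / (2 - \<epsilon>) * H powr (2 - \<epsilon>)) / s\<^sup>2"
proof -
  define Z where "Z p \<omega> = (X p \<omega>)\<^sup>2 * indicator {..<H} \<bar>X p \<omega>\<bar> - (1 - (b / H) powr \<epsilon>)" for p \<omega>
  have mX: "X p \<in> borel_measurable M" if "p \<in> I" for p
    using that I by (intro meas) auto
  have [measurable]: "Z p \<in> borel_measurable M" if "p \<in> I" for p
    using mX[OF that] unfolding Z_def[abs_def] by measurable
  have moments: "expectation (Z p) = 0 \<and> integrable M (\<lambda>\<omega>. (Z p \<omega>)\<^sup>2) \<and>
      expectation (\<lambda>\<omega>. (Z p \<omega>)\<^sup>2) \<le> \<epsilon> * b powr \<epsilon> / (2 - \<epsilon>) * H powr (2 - \<epsilon>)" if "p \<in> I" for p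
  proof -
    let ?T = "\<lambda>\<omega>. (X p \<omega>)\<^sup>2 * indicator {..<H} \<bar>X p \<omega>\<bar> :: real"
    have p: "p \<in> {1..} \<times> {1..}" using that I(2) by auto
    note T = truncated_second_moment[OF p H] and T2 = truncated_fourth_moment[OF p H]
    have Z: "Z p = (\<lambda>\<omega>. ?T \<omega> - expectation ?T)"
      by (simp add: Z_def[abs_def] T)
    have "expectation (\<lambda>\<omega>. (Z p \<omega>)\<^sup>2) = expectation (\<lambda>\<omega>. (?T \<omega>)\<^sup>2) - (expectation ?T)\<^sup>2"
      unfolding Z by (rule variance_eq[OF T(1) T2(1)])
    also have "\<dots> \<le> \<epsilon> * b powr \<epsilon> / (2 - \<epsilon>) * H powr (2 - \<epsilon>)"
      using T2(2) by (smt (verit) zero_le_power2)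
    finally have "expectation (\<lambda>\<omega>. (Z p \<omega>)\<^sup>2) \<le> \<epsilon> * b powr \<epsilon> / (2 - \<epsilon>) * H powr (2 - \<epsilon>)" .
    moreover have "expectation (Z p) = 0"
      unfolding Z using T(1) by (simp add: prob_space)
    moreover have "integrable M (\<lambda>\<omega>. (Z p \<omega>)\<^sup>2)"
      unfolding Z power2_diff using T T2 by simp
    ultimately show ?thesis by blast
  qed
  have indZ: "indep_vars (\<lambda>_. borel) Z I"
    using indep_vars_compose2[OF indep_vars_subset[OF ind I(2)],
        of "\<lambda>_ x. x\<^sup>2 * indicator {..<H} \<bar>x\<bar> - (1 - (b / H) powr \<epsilon>)" "\<lambda>_. borel"]
    unfolding Z_def[abs_def] by simp
  have int: "integrable M (\<lambda>\<omega>. (\<Sum>p\<in>I. Z p \<omega>)\<^sup>2)"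
    and E: "expectation (\<lambda>\<omega>. (\<Sum>p\<in>I. Z p \<omega>)\<^sup>2) = (\<Sum>p\<in>I. expectation (\<lambda>\<omega>. (Z p \<omega>)\<^sup>2))"
    using moments by (intro indep_vars_expectation_sum_square[OF I(1) indZ]; simp)+
  have "prob {\<omega>\<in>space M. (\<Sum>p\<in>I. (X p \<omega>)\<^sup>2 * indicator {..<H} \<bar>X p \<omega>\<bar>) \<le>
      real (card I) * (1 - (b / H) powr \<epsilon>) - s} \<le> prob {\<omega>\<in>space M. s \<le> \<bar>\<Sum>p\<in>I. Z p \<omega>\<bar>}"
  proof (rule finite_measure_mono)
    have "(\<Sum>p\<in>I. Z p \<omega>) = (\<Sum>p\<in>I. (X p \<omega>)\<^sup>2 * indicator {..<H} \<bar>X p \<omega>\<bar>) -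
        real (card I) * (1 - (b / H) powr \<epsilon>)" for \<omega>
      unfolding Z_def sum_subtractf by (simp add: algebra_simps)
    then show "{\<omega>\<in>space M. (\<Sum>p\<in>I. (X p \<omega>)\<^sup>2 * indicator {..<H} \<bar>X p \<omega>\<bar>) \<le>
        real (card I) * (1 - (b / H) powr \<epsilon>) - s} \<subseteq> {\<omega>\<in>space M. s \<le> \<bar>\<Sum>p\<in>I. Z p \<omega>\<bar>}"
      by fastforce
  qed measurable
  also have "\<dots> \<le> expectation (\<lambda>\<omega>. (\<Sum>p\<in>I. Z p \<omega>)\<^sup>2) / s\<^sup>2"
    by (intro second_moment_method int s) auto
  also have "\<dots> \<le> (\<Sum>p\<in>I. \<epsilon> * b powr \<epsilon> / (2 - \<epsilon>) * H powr (2 - \<epsilon>)) / s\<^sup>2"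
    unfolding E using moments by (intro divide_right_mono sum_mono) auto
  finally show ?thesis by simp
qed

end

text \<open>The truncation level \<open>t\<close> and the jump size \<open>S\<close> (in units of \<open>N\<^bsup>1/(2+\<epsilon>)\<^esup>\<close>) are coupled so that
  truncation costs a quarter of the jump; for small \<open>t\<close> the probability that the truncated sum deviates
  by another quarter is then negligible compared with the probability of the jump.\<close>

lemma big_jump:
  fixes \<epsilon> :: real
  assumes \<epsilon>: "0 < \<epsilon>" "\<epsilon> < 2"
  obtains p x :: real and N\<^sub>0 :: nat where "p > 0" "x > 0"
    "\<And>(M :: 'a measure) X (I :: (nat \<times> nat) set). noise M \<epsilon> X \<Longrightarrow> finite I \<Longrightarrow> I \<subseteq> {1..} \<times> {1..} \<Longrightarrow> N\<^sub>0 \<le> card I \<Longrightarrow>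
      measure M {\<omega>\<in>space M. real (card I) + x * real (card I) powr (2 / (2 + \<epsilon>)) \<le>
        (\<Sum>p\<in>I. (X p \<omega>)\<^sup>2)} \<ge> p"
proof -
  define b where "b = noise_scale \<epsilon>"
  define C where "C = \<epsilon> * b powr \<epsilon> / (2 - \<epsilon>)"
  \<comment> \<open>The bound by \<open>b\<close> yields \<open>S \<ge> 2\<close>; the other entry
    of the minimum is solved from the inequality \<open>Cheb\<close> below.\<close>
  define t where "t = min b ((b powr (2 + \<epsilon>) / (64 * C)) powr (1 / (2 - \<epsilon>)))"
  define S where "S = 2 * (b / t) powr (\<epsilon> / 2)"
  \<comment> \<open>The expected number of observations beyond \<open>S * w\<close>, where
    \<open>w\<close> is \<open>card I\<close> to the power \<open>1 / (2 + \<epsilon>)\<close>. In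
    this scaling it does not depend on \<open>card I\<close>, and \<open>\<mu> \<le> 1\<close> is
    what \<open>prob_jump\<close> asks for.\<close>
  define \<mu> where "\<mu> = (b / S) powr (2 + \<epsilon>)"
  have b: "b > 0" "b < 1"
  proof -
    have "b\<^sup>2 < 1" using \<epsilon> by (simp add: b_def noise_scale_sq)
    then show "b < 1" using power_less_imp_less_base[of b 2 1] by simp
  qed (simp add: b_def noise_scale_pos \<epsilon>)
  have C: "C > 0" using \<epsilon> b by (simp add: C_def)
  have t: "t > 0" "t \<le> b" using b C \<epsilon> by (auto simp: t_def)
  have S: "S \<ge> 2"
    using t b \<epsilon> by (simp add: S_def ge_one_powr_ge_zero)
  have S2: "S\<^sup>2 = 4 * (b / t) powr \<epsilon>"
    using t b by (simp add: S_def power_mult_distrib power2_eq_square powr_add[symmetric])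
  have \<mu>: "\<mu> > 0" "\<mu> \<le> 1"
    using b S \<epsilon> by (auto simp: \<mu>_def intro!: powr_le1)
  \<comment> \<open>The left side is the Chebyshev bound for a deviation by
    \<open>S\<^sup>2 / 4 * w\<^sup>2\<close> once the powers of \<open>w\<close> have cancelled. It
    is kept at half of the lower bound \<open>\<mu> / 2\<close> for the jump.\<close>
  have Cheb: "16 * C * t powr (2 - \<epsilon>) / S ^ 4 \<le> \<mu> / 4"
  proof -
    have "(t / S) powr (2 - \<epsilon>) \<le> t powr (2 - \<epsilon>)"
      using t S \<epsilon> by (intro powr_mono2) (auto simp: divide_le_eq)
    also have "\<dots> \<le> ((b powr (2 + \<epsilon>) / (64 * C)) powr (1 / (2 - \<epsilon>))) powr (2 - \<epsilon>)"
      using t \<epsilon> by (intro powr_mono2) (auto simp: t_def)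
    also have "\<dots> = b powr (2 + \<epsilon>) / (64 * C)"
      using C b \<epsilon> by (simp add: powr_powr)
    finally have *: "64 * C * (t powr (2 - \<epsilon>) / S powr (2 - \<epsilon>)) \<le> b powr (2 + \<epsilon>)"
      using C t S by (simp add: powr_divide field_simps)
    have S4: "S ^ 4 = S powr (2 - \<epsilon>) * S powr (2 + \<epsilon>)"
      using S by (simp add: powr_add[symmetric])
    show ?thesis
      using * S b by (simp add: S4 \<mu>_def powr_divide field_simps)
  qed
  show ?thesis
  \<comment> \<open>From the \<open>S\<^sup>2 * w\<^sup>2\<close> contributed by a jump, truncation
    and deviation each remove a quarter, leaving \<open>S\<^sup>2 / 2\<close>; the probability left
    is \<open>\<mu> / 2 - \<mu> / 4\<close>. The size condition makes \<open>I\<close> nonempty and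
    gives \<open>b \<le> t * w\<close>, so both levels lie above \<open>b\<close>.\<close>
  proof (rule that[of "\<mu> / 4" "S\<^sup>2 / 2" "nat \<lceil>(b / t) powr (2 + \<epsilon>)\<rceil> + 1"])
    fix M :: "'a measure" and X and I :: "(nat \<times> nat) set"
    assume "noise M \<epsilon> X" and I: "finite I" "I \<subseteq> {1..} \<times> {1..}"
      and N: "nat \<lceil>(b / t) powr (2 + \<epsilon>)\<rceil> + 1 \<le> card I"
    interpret noise M \<epsilon> X by fact
    define N' where "N' = real (card I)"
    define w where "w = N' powr (1 / (2 + \<epsilon>))"
    have "N' > 0" using N by (simp add: N'_def)
    then have w: "w > 0" by (simp add: w_def)
    have Nw: "N' = w powr (2 + \<epsilon>)"
      using \<open>N' > 0\<close> \<epsilon> by (simp add: w_def powr_powr)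
    have w2: "N' powr (2 / (2 + \<epsilon>)) = w\<^sup>2"
      using \<open>N' > 0\<close> by (simp add: w_def power2_eq_square powr_add[symmetric])
    have "(b / t) powr (2 + \<epsilon>) \<le> N'"
      using N unfolding N'_def by linarith
    then have "((b / t) powr (2 + \<epsilon>)) powr (1 / (2 + \<epsilon>)) \<le> w"
      unfolding w_def using \<epsilon> by (intro powr_mono2) auto
    then have "b / t \<le> w"
      using b t \<epsilon> by (simp add: powr_powr)
    then have h: "b \<le> t * w"
      using t by (simp add: field_simps)
    have tS: "t * w \<le> S * w" using t S b w by simp
    then have H: "b \<le> S * w" using h by linarith
    have \<mu>N: "N' * (b / (S * w)) powr (2 + \<epsilon>) = \<mu>"
      using b S w by (simp add: \<mu>_def Nw powr_divide powr_mult)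
    have mX: "X p \<in> borel_measurable M" if "p \<in> I" for p
      using that I by (intro meas) auto
    let ?T = "\<lambda>\<omega>. \<Sum>p\<in>I. (X p \<omega>)\<^sup>2 * indicator {..<t * w} \<bar>X p \<omega>\<bar>"
    let ?J = "{\<omega>\<in>space M. \<exists>p\<in>I. S * w \<le> \<bar>X p \<omega>\<bar>}"
    let ?B = "{\<omega>\<in>space M. ?T \<omega> \<le> N' * (1 - (b / (t * w)) powr \<epsilon>) - S\<^sup>2 / 4 * w\<^sup>2}"
    let ?G = "{\<omega>\<in>space M. N' + S\<^sup>2 / 2 * N' powr (2 / (2 + \<epsilon>)) \<le> (\<Sum>p\<in>I. (X p \<omega>)\<^sup>2)}"
    have meas_T: "?T \<in> borel_measurable M"
      using mX by measurable
    have B [measurable]: "?B \<in> events" using meas_T by measurable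
    have G [measurable]: "?G \<in> events" using mX by measurable
    have J [measurable]: "?J \<in> events"
      using mX by (intro sets.sets_Collect_finite_Ex I(1)) measurable
    have "I \<noteq> {}" using N by auto
    then have PJ: "prob ?J \<ge> \<mu> / 2"
      using prob_jump[OF I(1) _ I(2), of "S * w"] H \<mu> \<mu>N by (simp add: b_def N'_def)
    have PB: "prob ?B \<le> \<mu> / 4"
    proof -
      have "prob ?B \<le> N' * (C * (t * w) powr (2 - \<epsilon>)) / (S\<^sup>2 / 4 * w\<^sup>2)\<^sup>2"
        using prob_truncated_sum[OF I, of "t * w" "S\<^sup>2 / 4 * w\<^sup>2"] h w S by (simp add: b_def N'_def C_def)
      also have "N' * (C * (t * w) powr (2 - \<epsilon>)) = C * t powr (2 - \<epsilon>) * w ^ 4"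
      proof -
        have "w powr (2 + \<epsilon>) * w powr (2 - \<epsilon>) = w ^ 4"
          using w by (simp add: powr_add[symmetric])
        then show ?thesis using t w by (simp add: Nw powr_mult mult_ac)
      qed
      also have "C * t powr (2 - \<epsilon>) * w ^ 4 / (S\<^sup>2 / 4 * w\<^sup>2)\<^sup>2 = 16 * C * t powr (2 - \<epsilon>) / S ^ 4"
        using w S by (simp add: field_simps power2_eq_square power4_eq_xxxx)
      also note Cheb
      finally show ?thesis .
    qed
    \<comment> \<open>Since \<open>t * w \<le> S * w\<close>, a jump is missing from the truncated
      sum and can be added to it in full.\<close>
    have "?J \<subseteq> ?G \<union> ?B"
    proof safe
      fix \<omega> p assume \<omega>: "\<omega> \<in> space M" and p: "p \<in> I" "S * w \<le> \<bar>X p \<omega>\<bar>"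
        and nB: "\<not> ?T \<omega> \<le> N' * (1 - (b / (t * w)) powr \<epsilon>) - S\<^sup>2 / 4 * w\<^sup>2"
      have "(\<Sum>p\<in>I. (X p \<omega>)\<^sup>2) - ?T \<omega> = (\<Sum>p\<in>I. (X p \<omega>)\<^sup>2 * indicator {t * w..} \<bar>X p \<omega>\<bar>)"
        unfolding sum_subtractf[symmetric] by (intro sum.cong) (auto split: split_indicator)
      also have "\<dots> \<ge> (\<Sum>p\<in>{p}. (X p \<omega>)\<^sup>2 * indicator {t * w..} \<bar>X p \<omega>\<bar>)"
        using I p by (intro sum_mono2) auto
      also have "(\<Sum>p\<in>{p}. (X p \<omega>)\<^sup>2 * indicator {t * w..} \<bar>X p \<omega>\<bar>) = \<bar>X p \<omega>\<bar>\<^sup>2"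
        using p tS by simp
      also have "(S * w)\<^sup>2 \<le> \<bar>X p \<omega>\<bar>\<^sup>2"
        using p S w by (intro power_mono) auto
      finally have "(\<Sum>p\<in>I. (X p \<omega>)\<^sup>2) \<ge> ?T \<omega> + S\<^sup>2 * w\<^sup>2"
        by (simp add: power_mult_distrib)
      moreover have "N' * (b / (t * w)) powr \<epsilon> = S\<^sup>2 / 4 * w\<^sup>2"
      proof -
        have "w powr (2 + \<epsilon>) / w powr \<epsilon> = w\<^sup>2" using w by (simp add: powr_diff[symmetric])
        then show ?thesis using b t w by (simp add: Nw S2 powr_divide powr_mult field_simps)
      qed
      then have "N' * (1 - (b / (t * w)) powr \<epsilon>) = N' - S\<^sup>2 / 4 * w\<^sup>2"
        by (simp add: algebra_simps)
      ultimately show "N' + S\<^sup>2 / 2 * N' powr (2 / (2 + \<epsilon>)) \<le> (\<Sum>p\<in>I. (X p \<omega>)\<^sup>2)"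
        using nB unfolding w2 by linarith
    qed
    then have "prob ?J \<le> prob (?G \<union> ?B)"
      by (rule finite_measure_mono[OF _ sets.Un[OF G B]])
    also have "\<dots> \<le> prob ?G + prob ?B"
      by (rule measure_Un_le[OF G B])
    finally show "\<mu> / 4 \<le> measure M {\<omega>\<in>space M. real (card I) + S\<^sup>2 / 2 * real (card I) powr (2 / (2 + \<epsilon>)) \<le>
        (\<Sum>p\<in>I. (X p \<omega>)\<^sup>2)}"
      using PJ PB unfolding N'_def by linarith
  qed (use \<mu> S in auto)
qed

section \<open>Stopping index and error\<close>

context diagonal
begin

text \<open>Expresses the error through finitely many data components and a constant, from which its
  measurability can be read off.\<close>

lemma norm_cutoff_diff_sq:
  assumes "\<alpha> > 0"
  defines "A m \<equiv> {l\<in>{1..m}. real l powr (- q) \<ge> \<alpha>}"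
  shows "(norm (spectral_cutoff m K \<alpha> y - x))\<^sup>2 =
    (\<Sum>l\<in>A m. (y l / \<sigma> l)\<^sup>2) - 2 * (\<Sum>l\<in>A m. y l / \<sigma> l * coord x l) + (norm x)\<^sup>2"
proof -
  let ?z = "\<Sum>l\<in>A m. (y l / \<sigma> l) *\<^sub>R basis_vec l"
  have A: "finite (A m)" "0 \<notin> A m" by (auto simp: A_def)
  have i: "inner ?z u = (\<Sum>l\<in>A m. y l / \<sigma> l * coord u l)" for u
    by (simp add: inner_sum_left)
  have "inner ?z ?z = (\<Sum>l\<in>A m. (y l / \<sigma> l)\<^sup>2)"
    unfolding i coord_sum_basis_vec[OF A] by (simp add: power2_eq_square)
  moreover have "inner x ?z = inner ?z x" by (rule inner_commute)
  moreover have "(norm (?z - x))\<^sup>2 = inner ?z ?z - inner ?z x - (inner x ?z - inner x x)"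
    unfolding power2_norm_eq_inner inner_diff_left inner_diff_right by simp
  ultimately show ?thesis
    unfolding spectral_cutoff_eq[OF assms(1)] A_def[symmetric]
    by (simp add: i power2_norm_eq_inner[symmetric])
qed

text \<open>The least index is attained: once \<open>\<theta> ^ k\<close> is below all
  \<open>l powr (- q)\<close> with \<open>l \<le> m\<close>, nothing is cut off and the residual is
  0.\<close>

lemma discrepancy_alpha_cases:
  assumes "0 < \<theta>" "\<theta> < 1" "0 \<le> \<kappa>"
  obtains k where "discrepancy_alpha m K \<theta> \<kappa> y = \<theta> ^ k"
    "(\<Sum>l\<in>{l\<in>{1..m}. real l powr (- q) < \<theta> ^ k}. (y l)\<^sup>2) \<le> \<kappa>\<^sup>2"
    "\<forall>k'. (\<Sum>l\<in>{l\<in>{1..m}. real l powr (- q) < \<theta> ^ k'}. (y l)\<^sup>2) \<le> \<kappa>\<^sup>2 \<longrightarrow> k \<le> k'"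
proof -
  define P where "P k \<longleftrightarrow> (\<Sum>l\<in>{l\<in>{1..m}. real l powr (- q) < \<theta> ^ k}. (y l)\<^sup>2) \<le> \<kappa>\<^sup>2" for k
  have "(L2_set (\<lambda>l. discretise m (K (spectral_cutoff m K (\<theta> ^ k) y)) l - y l) {1..m} \<le> \<kappa>) = P k" for k
    unfolding P_def residual_eq[OF zero_less_power[OF assms(1)]]
    using assms(3) by (auto intro: real_le_lsqrt dest: sqrt_le_D)
  then have eq: "discrepancy_alpha m K \<theta> \<kappa> y = \<theta> ^ (LEAST k. P k)"
    by (simp add: discrepancy_alpha_def)
  have "\<exists>k. P k"
  proof -
    \<comment> \<open>\<open>Suc m\<close> instead of \<open>m\<close> keeps the bound positive for
      \<open>m = 0\<close>, as \<open>0 powr s = 0\<close>.\<close>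
    obtain k where k: "\<theta> ^ k < real (Suc m) powr (- q)"
      using real_arch_pow_inv[of "real (Suc m) powr (- q)" \<theta>] assms by auto
    have "real (Suc m) powr (- q) \<le> real l powr (- q)" if "l \<in> {1..m}" for l
      using that q by (intro powr_mono2') auto
    then have "{l\<in>{1..m}. real l powr (- q) < \<theta> ^ k} = {}"
      using k by fastforce
    then have "P k" unfolding P_def by (simp only: sum.empty) simp
    then show ?thesis ..
  qed
  then have "P (LEAST k. P k)" by (rule LeastI_ex)
  then show ?thesis
    using that[of "LEAST k. P k"] eq Least_le[of P] unfolding P_def by blast
qed

text \<open>At index \<open>k0\<close> the first \<open>J\<close> components are all included, so a
  small tail forces stopping by then. A component \<open>j\<close> so far out that it is cut off
  even at \<open>\<theta> ^ k0\<close> is never reconstructed. Both \<open>k0\<close> and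
  \<open>j\<close> are fixed before \<open>m\<close>, the data and the threshold.\<close>

lemma error_ge_of_small_tail:
  assumes \<theta>: "0 < \<theta>" "\<theta> < 1"
  obtains j where "j \<ge> 1"
    "\<And>m (\<kappa> :: real) y x. 0 \<le> \<kappa> \<Longrightarrow> (\<Sum>l\<in>{J + 1..m}. (y l)\<^sup>2) \<le> \<kappa>\<^sup>2 \<Longrightarrow>
      \<bar>coord x j\<bar> \<le> norm (spectral_cutoff m K (discrepancy_alpha m K \<theta> \<kappa> y) y - x)"
proof -
  obtain k0 where k0: "\<theta> ^ k0 < real (Suc J) powr (- q)"
    using real_arch_pow_inv[of "real (Suc J) powr (- q)" \<theta>] assms by auto
  have "((\<lambda>j. real j powr (- q)) \<longlongrightarrow> 0) sequentially"
    using q by (intro tendsto_neg_powr filterlim_real_sequentially) auto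
  then have "\<forall>\<^sub>F j in sequentially. real j powr (- q) < \<theta> ^ k0"
    using \<theta> by (intro order_tendstoD) auto
  then obtain j where j: "j \<ge> 1" "real j powr (- q) < \<theta> ^ k0"
    using eventually_happens'[OF sequentially_bot eventually_conj[OF eventually_ge_at_top[of 1]]] by blast
  show ?thesis
  proof (rule that[of j])
    fix m and \<kappa> :: real and y and x
    assume \<kappa>: "0 \<le> \<kappa>" and le: "(\<Sum>l\<in>{J + 1..m}. (y l)\<^sup>2) \<le> \<kappa>\<^sup>2"
    obtain k where k: "discrepancy_alpha m K \<theta> \<kappa> y = \<theta> ^ k"
      and "(\<Sum>l\<in>{l\<in>{1..m}. real l powr (- q) < \<theta> ^ k}. (y l)\<^sup>2) \<le> \<kappa>\<^sup>2"
      and k_le: "\<forall>k'. (\<Sum>l\<in>{l\<in>{1..m}. real l powr (- q) < \<theta> ^ k'}. (y l)\<^sup>2) \<le> \<kappa>\<^sup>2 \<longrightarrow> k \<le> k'"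
      by (rule discrepancy_alpha_cases[OF \<theta> \<kappa>, of m y])
    have "{l\<in>{1..m}. real l powr (- q) < \<theta> ^ k0} \<subseteq> {J + 1..m}"
    proof safe
      fix l assume l: "l \<in> {1..m}" "real l powr (- q) < \<theta> ^ k0"
      have "l > J"
      proof (rule ccontr)
        assume "\<not> l > J"
        then have "real (Suc J) powr (- q) \<le> real l powr (- q)"
          using l q by (intro powr_mono2') auto
        with l k0 show False by simp
      qed
      then show "l \<in> {J + 1..m}" using l by auto
    qed
    then have "(\<Sum>l\<in>{l\<in>{1..m}. real l powr (- q) < \<theta> ^ k0}. (y l)\<^sup>2) \<le> (\<Sum>l\<in>{J + 1..m}. (y l)\<^sup>2)"
      by (intro sum_mono2) auto
    then have "k \<le> k0" using le by (intro k_le[rule_format]) linarith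
    then have "\<theta> ^ k0 \<le> \<theta> ^ k" using \<theta> by (intro power_decreasing) auto
    then have "\<not> \<theta> ^ k \<le> real j powr (- q)" using j by linarith
    then have "coord (spectral_cutoff m K (\<theta> ^ k) y) j = 0"
      using \<theta> by (simp add: coord_spectral_cutoff)
    then have "\<bar>coord (spectral_cutoff m K (\<theta> ^ k) y - x) j\<bar> = \<bar>coord x j\<bar>" by simp
    then show "\<bar>coord x j\<bar> \<le> norm (spectral_cutoff m K (discrepancy_alpha m K \<theta> \<kappa> y) y - x)"
      unfolding k by (metis abs_coord_le_norm)
  qed (rule j)
qed

text \<open>Components are cut off from the top. If some \<open>l \<le> J\<close> were still missing
  at the stopping index, all of \<open>J + 1..m\<close> would be missing too and the residual would
  exceed the threshold. Hence every \<open>l\<close> in \<open>I\<close> is included and carries the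
  amplification \<open>1 / (\<sigma> l)\<^sup>2 = l powr q\<close>.\<close>

lemma error_ge_of_large_tail:
  assumes \<theta>: "0 < \<theta>" "\<theta> < 1" and \<kappa>: "0 \<le> \<kappa>" and gt: "(\<Sum>l\<in>{J + 1..m}. (y l)\<^sup>2) > \<kappa>\<^sup>2"
    and I: "I \<subseteq> {1..J}"
  shows "(\<Sum>l\<in>I. real l powr q * (y l)\<^sup>2) \<le>
    (norm (spectral_cutoff m K (discrepancy_alpha m K \<theta> \<kappa> y) y))\<^sup>2"
proof -
  obtain k where k: "discrepancy_alpha m K \<theta> \<kappa> y = \<theta> ^ k"
    "(\<Sum>l\<in>{l\<in>{1..m}. real l powr (- q) < \<theta> ^ k}. (y l)\<^sup>2) \<le> \<kappa>\<^sup>2"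
    by (rule discrepancy_alpha_cases[OF \<theta> \<kappa>, of m y])
  have "J + 1 \<le> m"
    using gt by (rule contrapos_pp) simp
  have incl: "\<theta> ^ k \<le> real l powr (- q)" if l: "l \<in> I" for l
  proof (rule ccontr)
    assume "\<not> \<theta> ^ k \<le> real l powr (- q)"
    then have lk: "real l powr (- q) < \<theta> ^ k" by simp
    have "real l' powr (- q) \<le> real l powr (- q)" if "l' \<in> {J + 1..m}" for l'
      using that l I q by (intro powr_mono2') auto
    then have "{J + 1..m} \<subseteq> {l\<in>{1..m}. real l powr (- q) < \<theta> ^ k}"
      using lk by fastforce
    then have "(\<Sum>l\<in>{J + 1..m}. (y l)\<^sup>2) \<le> (\<Sum>l\<in>{l\<in>{1..m}. real l powr (- q) < \<theta> ^ k}. (y l)\<^sup>2)"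
      by (intro sum_mono2) auto
    with k gt show False by linarith
  qed
  have "(\<Sum>l\<in>I. real l powr q * (y l)\<^sup>2) = (\<Sum>l\<in>I. (coord (spectral_cutoff m K (\<theta> ^ k) y) l)\<^sup>2)"
  proof (intro sum.cong refl)
    fix l assume l: "l \<in> I"
    then have l1: "l \<in> {1..m}" using I \<open>J + 1 \<le> m\<close> by auto
    then have \<sigma>l: "(\<sigma> l)\<^sup>2 = real l powr (- q)" by (simp add: \<sigma>)
    have c: "coord (spectral_cutoff m K (\<theta> ^ k) y) l = y l / \<sigma> l"
      using \<theta> l1 incl[OF l] by (simp add: coord_spectral_cutoff)
    show "real l powr q * (y l)\<^sup>2 = (coord (spectral_cutoff m K (\<theta> ^ k) y) l)\<^sup>2"
      unfolding c power_divide \<sigma>l powr_minus by (simp add: divide_inverse)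
  qed
  also have "\<dots> \<le> (norm (spectral_cutoff m K (\<theta> ^ k) y))\<^sup>2"
    using I finite_subset by (intro norm_ell2_sq_ge) auto
  finally show ?thesis unfolding k(1) .
qed

text \<open>The stopping index is measurable with countably many values, and for each fixed index
  the error is a measurable function of the data.\<close>

lemma error_measurable:
  assumes \<theta>: "0 < \<theta>" and y: "\<And>l. l \<in> {1..m} \<Longrightarrow> (\<lambda>\<omega>. y \<omega> l) \<in> borel_measurable M"
    and \<kappa> [measurable]: "\<kappa> \<in> borel_measurable M"
  shows "(\<lambda>\<omega>. norm (spectral_cutoff m K (discrepancy_alpha m K \<theta> (\<kappa> \<omega>) (y \<omega>)) (y \<omega>) - x))
    \<in> borel_measurable M"
proof -
  define k where "k \<omega> = (LEAST k. sqrt (\<Sum>l\<in>{l\<in>{1..m}. real l powr (- q) < \<theta> ^ k}. (y \<omega> l)\<^sup>2) \<le> \<kappa> \<omega>)" for \<omega>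
  have \<alpha>: "discrepancy_alpha m K \<theta> (\<kappa> \<omega>) (y \<omega>) = \<theta> ^ k \<omega>" for \<omega>
    unfolding discrepancy_alpha_def k_def residual_eq[OF zero_less_power[OF \<theta>]] ..
  have "(\<lambda>\<omega>. sqrt (\<Sum>l\<in>{l\<in>{1..m}. real l powr (- q) < \<theta> ^ k}. (y \<omega> l)\<^sup>2)) \<in> borel_measurable M" for k
    using y by measurable
  then have [measurable]: "k \<in> measurable M (count_space UNIV)"
    unfolding k_def[abs_def] by measurable
  have "(\<lambda>\<omega>. norm (spectral_cutoff m K (\<theta> ^ k) (y \<omega>) - x)) \<in> borel_measurable M" for k
  proof -
    have "norm (spectral_cutoff m K (\<theta> ^ k) (y \<omega>) - x) =
        sqrt ((\<Sum>l\<in>{l\<in>{1..m}. real l powr (- q) \<ge> \<theta> ^ k}. (y \<omega> l / \<sigma> l)\<^sup>2) -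
          2 * (\<Sum>l\<in>{l\<in>{1..m}. real l powr (- q) \<ge> \<theta> ^ k}. y \<omega> l / \<sigma> l * coord x l) + (norm x)\<^sup>2)" for \<omega>
      by (subst norm_cutoff_diff_sq[symmetric]) (auto simp: \<theta>)
    then show ?thesis using y by simp measurable
  qed
  from measurable_compose_countable[OF this, of k] show ?thesis
    unfolding \<alpha> by measurable
qed

end

context noise
begin

text \<open>\<open>col_sum\<close>, \<open>sq_sum\<close> and \<open>cross_sum\<close> are
  \<open>S\<^sub>j\<close>, \<open>T\<close> and \<open>U\<close> of the introduction, the latter
  two for an arbitrary set of columns, as claim (b) works with two separate blocks.\<close>

definition col_sum :: "nat \<Rightarrow> nat \<Rightarrow> 'a \<Rightarrow> real"
  where "col_sum n j \<omega> = (\<Sum>i=1..n. X (i, j) \<omega>)"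

definition sq_sum :: "nat \<Rightarrow> nat set \<Rightarrow> 'a \<Rightarrow> real"
  where "sq_sum n L \<omega> = (\<Sum>p\<in>{1..n} \<times> L. (X p \<omega>)\<^sup>2)"

definition cross_sum :: "nat \<Rightarrow> nat set \<Rightarrow> 'a \<Rightarrow> real"
  where "cross_sum n L \<omega> = (\<Sum>j\<in>L. offdiag {1..n} (\<lambda>i. X (i, j) \<omega>))"

lemma sum_col_sum_sq: "(\<Sum>j\<in>L. (col_sum n j \<omega>)\<^sup>2) = sq_sum n L \<omega> + cross_sum n L \<omega>"
proof -
  have "sq_sum n L \<omega> = (\<Sum>j\<in>L. \<Sum>i=1..n. (X (i, j) \<omega>)\<^sup>2)"
    unfolding sq_sum_def by (subst sum.swap) (simp add: sum.cartesian_product)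
  then show ?thesis
    by (simp add: cross_sum_def offdiag_def col_sum_def sum_subtractf)
qed

lemma X_measurable [measurable (raw)]: "i \<ge> 1 \<Longrightarrow> j \<ge> 1 \<Longrightarrow> X (i, j) \<in> borel_measurable M"
  by (rule meas) auto

lemma col_sum_measurable [measurable (raw)]: "j \<ge> 1 \<Longrightarrow> col_sum n j \<in> borel_measurable M"
  unfolding col_sum_def[abs_def] by (intro borel_measurable_sum X_measurable) auto

lemma sq_sum_measurable [measurable (raw)]: "L \<subseteq> {1..} \<Longrightarrow> sq_sum n L \<in> borel_measurable M"
  unfolding sq_sum_def[abs_def] by (intro borel_measurable_sum borel_measurable_power meas) auto

lemma cross_sum_measurable [measurable (raw)]: "L \<subseteq> {1..} \<Longrightarrow> cross_sum n L \<in> borel_measurable M"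
  unfolding cross_sum_def[abs_def] offdiag_def
  by (intro borel_measurable_sum borel_measurable_power borel_measurable_diff X_measurable) auto

text \<open>Noise bounded away from 0 gives the right order of magnitude surely up to a null set, in
  place of a law of large numbers.\<close>

lemma AE_sq_sum_ge:
  assumes "finite L" "L \<subseteq> {1..}"
  shows "AE \<omega> in M. b\<^sup>2 * (real n * real (card L)) \<le> sq_sum n L \<omega>"
proof -
  have "AE \<omega> in M. \<forall>p\<in>{1..n} \<times> L. b \<le> \<bar>X p \<omega>\<bar>"
    using assms by (intro AE_finite_allI AE_ge) auto
  then show ?thesis
  proof eventually_elim
    case (elim \<omega>)
    have "(\<Sum>p\<in>{1..n} \<times> L. b\<^sup>2) \<le> sq_sum n L \<omega>"
      unfolding sq_sum_def
    proof (rule sum_mono)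
      fix p assume "p \<in> {1..n} \<times> L"
      with elim have "b\<^sup>2 \<le> \<bar>X p \<omega>\<bar>\<^sup>2" using b_pos by (intro power_mono) auto
      then show "b\<^sup>2 \<le> (X p \<omega>)\<^sup>2" by simp
    qed
    then show ?case by (simp add: card_cartesian_product mult_ac)
  qed
qed

lemma prob_cross_sum:
  assumes L: "finite L" "L \<subseteq> {1..}" and s: "s > 0"
  shows "prob {\<omega>\<in>space M. s \<le> \<bar>cross_sum n L \<omega>\<bar>} \<le> 2 * real (card L) * (real n)\<^sup>2 / s\<^sup>2"
proof -
  have sub: "{1..n} \<times> L \<subseteq> {1..} \<times> {1..}" using L by auto
  have "integrable M (\<lambda>\<omega>. (cross_sum n L \<omega>)\<^sup>2)"
    and E: "expectation (\<lambda>\<omega>. (cross_sum n L \<omega>)\<^sup>2) \<le> 2 * real (card L) * (real (card {1..n}))\<^sup>2"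
    unfolding cross_sum_def using sub
    by (intro offdiag_columns_moments L indep_vars_subset[OF ind sub];
        use mean second_moment in blast)+
  then have "prob {\<omega>\<in>space M. s \<le> \<bar>cross_sum n L \<omega>\<bar>} \<le> expectation (\<lambda>\<omega>. (cross_sum n L \<omega>)\<^sup>2) / s\<^sup>2"
    using L by (intro second_moment_method s) auto
  also have "\<dots> \<le> 2 * real (card L) * (real n)\<^sup>2 / s\<^sup>2"
    using E by (intro divide_right_mono) auto
  finally show ?thesis .
qed

text \<open>Chebyshev's inequality for the mixed terms between exact data and noise that appear in
  the residual.\<close>

lemma prob_weighted_sum:
  assumes L: "finite L" "L \<subseteq> {1..}" and s: "s > 0"
  shows "prob {\<omega>\<in>space M. s \<le> \<bar>\<Sum>j\<in>L. a j * col_sum n j \<omega>\<bar>} \<le> real n * (\<Sum>j\<in>L. (a j)\<^sup>2) / s\<^sup>2"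
proof -
  define Z where "Z p \<omega> = a (snd p) * X p \<omega>" for p \<omega>
  have sub: "{1..n} \<times> L \<subseteq> {1..} \<times> {1..}" using L by auto
  have eq: "(\<Sum>j\<in>L. a j * col_sum n j \<omega>) = (\<Sum>p\<in>{1..n} \<times> L. Z p \<omega>)" for \<omega>
    unfolding Z_def col_sum_def sum_distrib_left
    by (subst sum.swap) (simp add: sum.cartesian_product case_prod_beta)
  have "indep_vars (\<lambda>_. borel) Z ({1..n} \<times> L)"
    using indep_vars_compose2[OF indep_vars_subset[OF ind sub], of "\<lambda>p x. a (snd p) * x" "\<lambda>_. borel"]
    unfolding Z_def[abs_def] by simp
  note ZS = indep_vars_expectation_sum_square[OF _ this]
  have fin: "finite ({1..n} \<times> L)" using L by simp
  have Z: "integrable M (\<lambda>\<omega>. (Z p \<omega>)\<^sup>2)" "expectation (Z p) = 0"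
    "expectation (\<lambda>\<omega>. (Z p \<omega>)\<^sup>2) = (a (snd p))\<^sup>2" if "p \<in> {1..n} \<times> L" for p
  proof -
    have p: "p \<in> {1..} \<times> {1..}" using that sub by blast
    show "integrable M (\<lambda>\<omega>. (Z p \<omega>)\<^sup>2)" "expectation (Z p) = 0"
      "expectation (\<lambda>\<omega>. (Z p \<omega>)\<^sup>2) = (a (snd p))\<^sup>2"
      unfolding Z_def[abs_def] power_mult_distrib using mean[OF p] second_moment[OF p] by simp_all
  qed
  have "prob {\<omega>\<in>space M. s \<le> \<bar>\<Sum>j\<in>L. a j * col_sum n j \<omega>\<bar>} \<le>
      expectation (\<lambda>\<omega>. (\<Sum>j\<in>L. a j * col_sum n j \<omega>)\<^sup>2) / s\<^sup>2"
  proof (rule second_moment_method)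
    show "integrable M (\<lambda>\<omega>. (\<Sum>j\<in>L. a j * col_sum n j \<omega>)\<^sup>2)"
      unfolding eq by (rule ZS[OF fin Z(1,2)])
    show "(\<lambda>\<omega>. \<Sum>j\<in>L. a j * col_sum n j \<omega>) \<in> borel_measurable M"
      using L by (intro borel_measurable_sum borel_measurable_times col_sum_measurable) auto
  qed (rule s)
  also have "expectation (\<lambda>\<omega>. (\<Sum>j\<in>L. a j * col_sum n j \<omega>)\<^sup>2) = (\<Sum>p\<in>{1..n} \<times> L. expectation (\<lambda>\<omega>. (Z p \<omega>)\<^sup>2))"
    unfolding eq by (rule ZS[OF fin Z(1,2)])
  also have "\<dots> = (\<Sum>p\<in>{1..n} \<times> L. (a (snd p))\<^sup>2)"
    by (rule sum.cong) (auto simp: Z)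
  also have "\<dots> = (\<Sum>i=1..n. \<Sum>j\<in>L. (a j)\<^sup>2)"
    unfolding sum.cartesian_product by (simp add: case_prod_beta)
  also have "\<dots> = real n * (\<Sum>j\<in>L. (a j)\<^sup>2)" by simp
  finally show ?thesis .
qed

end

section \<open>Non-convergence\<close>

text \<open>The union bound up to a null set, which absorbs the exceptional set of
  \<open>AE_sq_sum_ge\<close>.\<close>

lemma (in prob_space) prob_le_of_cover:
  assumes G: "G \<in> events" and E: "E \<in> events" "B \<in> events" "B' \<in> events"
    and cover: "AE \<omega> in M. \<omega> \<in> G \<longrightarrow> \<omega> \<in> E \<or> \<omega> \<in> B \<or> \<omega> \<in> B'"
  shows "prob G \<le> prob E + prob B + prob B'"
proof -
  have "prob G \<le> prob (E \<union> B \<union> B')"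
    using cover E by (intro finite_measure_mono_AE) auto
  also have "\<dots> \<le> prob (E \<union> B) + prob B'"
    using E by (intro measure_Un_le) auto
  also have "prob (E \<union> B) \<le> prob E + prob B"
    using E by (intro measure_Un_le) auto
  finally show ?thesis by simp
qed

text \<open>Largeness is demanded of \<open>m\<close> alone, and \<open>n\<close> is controlled
  through \<open>c * n \<le> m\<close>. The bound \<open>2 \<le> n\<close> keeps the denominator
  \<open>n - 1\<close> of the sample variance positive.\<close>

lemma eventually_mn_filterI:
  assumes P: "\<forall>\<^sub>F m in sequentially. P m"
    and Q: "\<And>m n. P m \<Longrightarrow> 2 \<le> n \<Longrightarrow> c * real n \<le> real m \<Longrightarrow> Q (m, n)"
  shows "\<forall>\<^sub>F p in mn_filter c. Q p"
proof -
  have "\<forall>\<^sub>F p in sequentially \<times>\<^sub>F sequentially. P (fst p) \<and> 2 \<le> snd p"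
    using P eventually_ge_at_top by (rule eventually_prodI)
  then have "\<forall>\<^sub>F p in sequentially \<times>\<^sub>F sequentially. p \<in> {(m, n). real m / real n \<ge> c} \<longrightarrow> Q p"
    by eventually_elim (auto intro!: Q simp: field_simps)
  then show ?thesis
    by (simp add: mn_filter_def eventually_inf_principal)
qed

lemma filterlim_mn_filter:
  "filterlim fst sequentially (mn_filter c)" "filterlim snd sequentially (mn_filter c)"
  unfolding mn_filter_def
  by (rule filterlim_mono[OF _ order_refl inf_le1]; rule filterlim_fst filterlim_snd)+

lemma eventually_le_powr:
  assumes "filterlim f at_top F" "s > (0::real)"
  shows "\<forall>\<^sub>F x in F. K \<le> f x powr s"
proof -
  have "\<forall>\<^sub>F x in F. max 1 K powr (1 / s) \<le> f x"
    using assms(1) by (auto simp: filterlim_at_top)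
  then show ?thesis
  proof eventually_elim
    case (elim x)
    have "K \<le> (max 1 K powr (1 / s)) powr s"
      using assms(2) by (simp add: powr_powr)
    also have "\<dots> \<le> f x powr s"
      using elim assms(2) by (intro powr_mono2) auto
    finally show ?case .
  qed
qed

lemma summable_tail_small:
  fixes f :: "nat \<Rightarrow> real"
  assumes "summable f" "r > 0"
  obtains J where "\<And>m. (\<Sum>l\<in>{J + 1..m}. f l) \<le> r"
proof -
  obtain N where N: "\<forall>m\<ge>N. \<forall>n. norm (sum f {m..<n}) < r"
    using assms unfolding summable_Cauchy by blast
  have "(\<Sum>l\<in>{N + 1..m}. f l) \<le> r" for m
    using N[rule_format, of "N + 1" "Suc m"] by (simp add: atLeastLessThanSuc_atLeastAtMost)
  then show ?thesis by (rule that)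
qed

section \<open>Claim (a): the estimated noise level\<close>

locale diagonal_noise = diagonal q K \<sigma> + noise M \<epsilon> X
  for q K \<sigma> and M :: "'a measure" and \<epsilon> X
begin

abbreviation data :: "nat \<Rightarrow> ell2 \<Rightarrow> 'a \<Rightarrow> nat \<Rightarrow> nat \<Rightarrow> real"
  where "data m yhat \<equiv> measurements m yhat (\<lambda>i j. X (i, j))"

abbreviation err :: "real \<Rightarrow> nat \<Rightarrow> nat \<Rightarrow> ell2 \<Rightarrow> ell2 \<Rightarrow> ('a \<Rightarrow> real) \<Rightarrow> 'a \<Rightarrow> real"
  where "err \<theta> m n yhat x \<kappa> \<omega> \<equiv>
    norm (spectral_cutoff m K (discrepancy_alpha m K \<theta> (\<kappa> \<omega>) (sample_mean n (data m yhat \<omega>)))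
      (sample_mean n (data m yhat \<omega>)) - x)"

lemma sample_mean_data:
  assumes "j \<in> {1..m}" "n \<ge> 1"
  shows "sample_mean n (data m yhat \<omega>) j = coord yhat j + col_sum n j \<omega> / real n"
  using assms
  by (simp add: sample_mean_def measurements_def discretise_def sum.distrib add_divide_distrib col_sum_def)

text \<open>Centring by the sample means removes the exact data, so the estimate depends only on
  \<open>T\<close> and \<open>U\<close>. The second statement, a sum of squares in disguise, permits
  squaring the root later.\<close>

lemma noise_level_est_data:
  assumes "m \<ge> 1" "n \<ge> 2"
  shows "noise_level_est m n (data m yhat \<omega>) =
      sqrt ((sq_sum n {1..m} \<omega> - (sq_sum n {1..m} \<omega> + cross_sum n {1..m} \<omega>) / real n) / (real n * (real n - 1)))"
    and "0 \<le> (sq_sum n {1..m} \<omega> - (sq_sum n {1..m} \<omega> + cross_sum n {1..m} \<omega>) / real n) / (real n * (real n - 1))"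
proof -
  let ?R = "sq_sum n {1..m} \<omega> - (sq_sum n {1..m} \<omega> + cross_sum n {1..m} \<omega>) / real n"
  have col: "(\<Sum>i=1..n. (data m yhat \<omega> i j - sample_mean n (data m yhat \<omega>) j)\<^sup>2) =
      (\<Sum>i=1..n. (X (i, j) \<omega>)\<^sup>2) - (col_sum n j \<omega>)\<^sup>2 / real n" if j: "j \<in> {1..m}" for j
  proof -
    let ?s = "col_sum n j \<omega> / real n"
    have "(\<Sum>i=1..n. (data m yhat \<omega> i j - sample_mean n (data m yhat \<omega>) j)\<^sup>2) =
        (\<Sum>i=1..n. (X (i, j) \<omega>)\<^sup>2 - 2 * ?s * X (i, j) \<omega> + ?s\<^sup>2)"
      using assms j by (intro sum.cong refl, subst sample_mean_data)
        (auto simp: measurements_def discretise_def power2_diff)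
    also have "\<dots> = (\<Sum>i=1..n. (X (i, j) \<omega>)\<^sup>2) - 2 * ?s * col_sum n j \<omega> + real n * ?s\<^sup>2"
      by (simp add: sum.distrib sum_subtractf sum_distrib_left col_sum_def)
    also have "2 * ?s * col_sum n j \<omega> = 2 * ((col_sum n j \<omega>)\<^sup>2 / real n)"
      by (simp add: power2_eq_square)
    also have "real n * ?s\<^sup>2 = (col_sum n j \<omega>)\<^sup>2 / real n"
      using assms by (simp add: power2_eq_square)
    finally show ?thesis by simp
  qed
  have "(\<Sum>j=1..m. \<Sum>i=1..n. (data m yhat \<omega> i j - sample_mean n (data m yhat \<omega>) j)\<^sup>2) =
      (\<Sum>j=1..m. (\<Sum>i=1..n. (X (i, j) \<omega>)\<^sup>2) - (col_sum n j \<omega>)\<^sup>2 / real n)"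
    by (rule sum.cong[OF refl col])
  also have "\<dots> = (\<Sum>j=1..m. \<Sum>i=1..n. (X (i, j) \<omega>)\<^sup>2) - (\<Sum>j=1..m. (col_sum n j \<omega>)\<^sup>2) / real n"
    by (simp add: sum_subtractf sum_divide_distrib)
  also have "(\<Sum>j=1..m. \<Sum>i=1..n. (X (i, j) \<omega>)\<^sup>2) = sq_sum n {1..m} \<omega>"
    unfolding sq_sum_def by (subst sum.swap) (simp add: sum.cartesian_product)
  finally have R: "(\<Sum>j=1..m. \<Sum>i=1..n. (data m yhat \<omega> i j - sample_mean n (data m yhat \<omega>) j)\<^sup>2) = ?R"
    by (simp add: sum_col_sum_sq)
  have "real m / real n * sample_var m n (data m yhat \<omega>) = ?R / (real n * (real n - 1))"
    using assms unfolding sample_var_def sum_divide_distrib[symmetric] R by simp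
  then show "noise_level_est m n (data m yhat \<omega>) = sqrt (?R / (real n * (real n - 1)))"
    by (simp add: noise_level_est_def)
  show "0 \<le> ?R / (real n * (real n - 1))"
    unfolding R[symmetric] using assms by (intro divide_nonneg_nonneg sum_nonneg) auto
qed

lemma err_measurable:
  assumes "0 < \<theta>" "n \<ge> 1" "\<kappa> \<in> borel_measurable M"
  shows "err \<theta> m n yhat x \<kappa> \<in> borel_measurable M"
proof (rule error_measurable[OF assms(1) _ assms(3)])
  fix l assume l: "l \<in> {1..m}"
  then have "(\<lambda>\<omega>. coord yhat l + col_sum n l \<omega> / real n) \<in> borel_measurable M"
    by (intro borel_measurable_add borel_measurable_divide col_sum_measurable) auto
  then show "(\<lambda>\<omega>. sample_mean n (data m yhat \<omega>) l) \<in> borel_measurable M"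
    using l assms(2) by (simp add: sample_mean_data)
qed

text \<open>The squared estimate equals \<open>T / n^2 - U / (n^2 * (n - 1))\<close>, so comparison
  with the residual leaves a surplus \<open>(\<tau>\<^sup>2 - 1) * T / n^2\<close>, at least
  \<open>D * m / n\<close>. Half of it absorbs both occurrences of \<open>U\<close>; the other half
  is at least \<open>D * c / 2\<close> and absorbs the signal terms.\<close>

lemma discrepancy_threshold_exceeded:
  fixes \<tau> c D T U V \<rho> :: real and n m :: nat
  assumes \<tau>: "\<tau> > 1" and c: "c > 0" and n: "n \<ge> 2" and mn: "c * real n \<le> real m"
    and D: "D > 0" "D * (real n * real m) \<le> (\<tau>\<^sup>2 - 1) * T"
    and U: "\<bar>U\<bar> * (1 + \<tau>\<^sup>2) \<le> D / 2 * (real n * real m)"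
    and V: "\<bar>V\<bar> \<le> D * c / 8 * real n" and \<rho>: "\<rho> \<le> D * c / 4"
  shows "\<rho> + 2 * V / real n + (T + U) / (real n)\<^sup>2 \<le>
    \<tau>\<^sup>2 * ((T - (T + U) / real n) / (real n * (real n - 1)))"
proof -
  define N where "N = real n"
  have N: "N \<ge> 2" using n by (simp add: N_def)
  have "\<rho> + 2 * V / N \<le> D * c / 4 + D * c / 4"
    using V \<rho> N by (intro add_mono) (auto simp: N_def field_simps)
  also have "\<dots> = D / 2 * (c * N) * N / N\<^sup>2"
    using N by (simp add: power2_eq_square)
  also have "\<dots> \<le> D / 2 * real m * N / N\<^sup>2"
    using N mn D by (intro divide_right_mono mult_right_mono mult_left_mono) (auto simp: N_def)
  finally have 1: "\<rho> + 2 * V / N \<le> D / 2 * (N * real m) / N\<^sup>2"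
    by (simp add: mult_ac)
  have 2: "\<bar>U\<bar> * (1 + \<tau>\<^sup>2) / N\<^sup>2 \<le> D / 2 * (N * real m) / N\<^sup>2"
    using U by (intro divide_right_mono) (auto simp: N_def)
  have 3: "D * (N * real m) / N\<^sup>2 \<le> (\<tau>\<^sup>2 - 1) * T / N\<^sup>2"
    using D by (intro divide_right_mono) (auto simp: N_def)
  have "U / (N\<^sup>2 * (N - 1)) \<le> \<bar>U\<bar> / N\<^sup>2"
  proof -
    have "U / (N\<^sup>2 * (N - 1)) \<le> \<bar>U\<bar> / (N\<^sup>2 * (N - 1))"
      using N by (intro divide_right_mono) auto
    also have "\<dots> \<le> \<bar>U\<bar> / N\<^sup>2"
      using N by (intro divide_left_mono) auto
    finally show ?thesis .
  qed
  then have 4: "\<tau>\<^sup>2 * (U / (N\<^sup>2 * (N - 1))) \<le> \<tau>\<^sup>2 * (\<bar>U\<bar> / N\<^sup>2)"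
    by (rule mult_left_mono) simp
  have 5: "(T - (T + U) / N) / (N * (N - 1)) = T / N\<^sup>2 - U / (N\<^sup>2 * (N - 1))"
    using N by (simp add: divide_simps power2_eq_square) (simp add: algebra_simps)
  have 6: "U / N\<^sup>2 \<le> \<bar>U\<bar> / N\<^sup>2"
    by (intro divide_right_mono) auto
  show ?thesis
    using 1 2 3 4 6 unfolding N_def[symmetric] 5
    by (simp add: algebra_simps add_divide_distrib diff_divide_distrib)
qed

text \<open>Once the exact data beyond \<open>J\<close> are small, the threshold exceeds the
  residual beyond \<open>J\<close> outside two events of vanishing probability, and
  \<open>error_ge_of_small_tail\<close> applies.\<close>

lemma no_convergence_estimated_noise_level:
  assumes \<tau>: "\<tau> > 1" and \<theta>: "0 < \<theta>" "\<theta> < 1" and c: "c > 0"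
    and x: "\<And>j. j \<ge> 1 \<Longrightarrow> coord x j \<noteq> 0"
  shows "\<exists>C>0. ((\<lambda>(m, n). prob {\<omega>\<in>space M.
      C \<le> err \<theta> m n yhat x (\<lambda>\<omega>. \<tau> * noise_level_est m n (data m yhat \<omega>)) \<omega>})
    \<longlongrightarrow> 1) (mn_filter c)"
proof -
  \<comment> \<open>Almost surely \<open>D * (n * m)\<close> is a lower bound for
    \<open>(\<tau>\<^sup>2 - 1) * T\<close>.\<close>
  define D where "D = (\<tau>\<^sup>2 - 1) * b\<^sup>2"
  define \<beta> where "\<beta> = D / (2 * (1 + \<tau>\<^sup>2))"
  have \<tau>2: "\<tau>\<^sup>2 > 1" using \<tau> by simp
  have D: "D > 0" using \<tau>2 b_pos by (simp add: D_def)
  have \<beta>: "\<beta> > 0" using D by (simp add: \<beta>_def add_pos_nonneg)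
  have \<beta>D: "\<beta> * (1 + \<tau>\<^sup>2) = D / 2"
    using \<tau>2 by (simp add: \<beta>_def field_simps)
  obtain J where J: "\<And>m. (\<Sum>l\<in>{J + 1..m}. (coord yhat l)\<^sup>2) \<le> D * c / 4"
    using summable_tail_small[OF summable_coord_sq, of "D * c / 4"] D c by auto
  obtain j where j: "j \<ge> 1" and err_ge: "\<And>m (\<kappa> :: real) y x. 0 \<le> \<kappa> \<Longrightarrow> (\<Sum>l\<in>{J + 1..m}. (y l)\<^sup>2) \<le> \<kappa>\<^sup>2 \<Longrightarrow>
      \<bar>coord x j\<bar> \<le> norm (spectral_cutoff m K (discrepancy_alpha m K \<theta> \<kappa> y) y - x)"
    using error_ge_of_small_tail[OF \<theta>, of J] by metis
  \<comment> \<open>\<open>j\<close> was fixed before \<open>m\<close>, \<open>n\<close> and the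
    noise, so one constant serves for the whole limit.\<close>
  define C where "C = \<bar>coord x j\<bar>"
  let ?E = "\<lambda>m n. {\<omega>\<in>space M. C \<le> err \<theta> m n yhat x (\<lambda>\<omega>. \<tau> * noise_level_est m n (data m yhat \<omega>)) \<omega>}"
  define R where "R = (norm yhat)\<^sup>2 / (D * c / 8)\<^sup>2"
  have lower: "1 - 2 / \<beta>\<^sup>2 / real m - R / real n \<le> prob (?E m n)"
    if n: "2 \<le> n" and mn: "c * real n \<le> real m" for m n
  proof -
    let ?V = "\<lambda>\<omega>. \<Sum>l\<in>{J + 1..m}. coord yhat l * col_sum n l \<omega>"
    let ?B = "{\<omega>\<in>space M. \<beta> * (real n * real m) \<le> \<bar>cross_sum n {1..m} \<omega>\<bar>}"
    let ?B' = "{\<omega>\<in>space M. D * c / 8 * real n \<le> \<bar>?V \<omega>\<bar>}"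
    have "0 < c * real n" using c n by simp
    then have m: "m \<ge> 1" using mn by (cases m) auto
    have [measurable]: "sq_sum n {1..m} \<in> borel_measurable M" "cross_sum n {1..m} \<in> borel_measurable M"
      by (intro sq_sum_measurable cross_sum_measurable; auto)+
    have [measurable]: "?V \<in> borel_measurable M"
      by (intro borel_measurable_sum borel_measurable_times col_sum_measurable) auto
    have [measurable]: "err \<theta> m n yhat x (\<lambda>\<omega>. \<tau> * noise_level_est m n (data m yhat \<omega>)) \<in> borel_measurable M"
      using n by (intro err_measurable \<theta>) (auto simp: noise_level_est_data[OF m n])
    \<comment> \<open>The cover is applied to the whole space: outside two bad events and a null set
      the error is at least \<open>C\<close>.\<close>
    have "prob (space M) \<le> prob (?E m n) + prob ?B + prob ?B'"
    proof (rule prob_le_of_cover)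
      have "AE \<omega> in M. b\<^sup>2 * (real n * real (card {1..m})) \<le> sq_sum n {1..m} \<omega>"
        by (rule AE_sq_sum_ge) auto
      then show "AE \<omega> in M. \<omega> \<in> space M \<longrightarrow> \<omega> \<in> ?E m n \<or> \<omega> \<in> ?B \<or> \<omega> \<in> ?B'"
      proof eventually_elim
        case (elim \<omega>)
        let ?T = "sq_sum n {1..m} \<omega>" and ?U = "cross_sum n {1..m} \<omega>"
        let ?y = "sample_mean n (data m yhat \<omega>)" and ?\<kappa> = "\<tau> * noise_level_est m n (data m yhat \<omega>)"
        show ?case
        proof (intro impI)
          assume \<omega>: "\<omega> \<in> space M"
          have "C \<le> norm (spectral_cutoff m K (discrepancy_alpha m K \<theta> ?\<kappa> ?y) ?y - x)"
            if "\<omega> \<notin> ?B" "\<omega> \<notin> ?B'"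
            unfolding C_def
          proof (rule err_ge)
            show "0 \<le> ?\<kappa>"
              using \<tau> noise_level_est_data(1)[OF m n, of yhat \<omega>] noise_level_est_data(2)[OF m n, of \<omega>]
              by simp
            have "(\<Sum>l\<in>{J + 1..m}. (?y l)\<^sup>2) =
                (\<Sum>l\<in>{J + 1..m}. (coord yhat l)\<^sup>2 + 2 * (coord yhat l * col_sum n l \<omega>) / real n +
                  (col_sum n l \<omega>)\<^sup>2 / (real n)\<^sup>2)"
              using n by (intro sum.cong refl, subst sample_mean_data)
                (auto simp: power2_sum power_divide)
            also have "\<dots> = (\<Sum>l\<in>{J + 1..m}. (coord yhat l)\<^sup>2) + 2 * ?V \<omega> / real n +
                (\<Sum>l\<in>{J + 1..m}. (col_sum n l \<omega>)\<^sup>2) / (real n)\<^sup>2"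
              by (simp add: sum.distrib sum_divide_distrib sum_distrib_left)
            \<comment> \<open>The noise of the first \<open>J\<close> columns is added so that the
              same \<open>T\<close> and \<open>U\<close> occur here as in the estimated noise
              level.\<close>
            also have "\<dots> \<le> (\<Sum>l\<in>{J + 1..m}. (coord yhat l)\<^sup>2) + 2 * ?V \<omega> / real n +
                (\<Sum>l\<in>{1..m}. (col_sum n l \<omega>)\<^sup>2) / (real n)\<^sup>2"
              by (intro add_left_mono divide_right_mono sum_mono2) auto
            also have "\<dots> \<le> \<tau>\<^sup>2 * ((?T - (?T + ?U) / real n) / (real n * (real n - 1)))"
              unfolding sum_col_sum_sq
            proof (rule discrepancy_threshold_exceeded[OF \<tau> c n mn D])
              have "(\<tau>\<^sup>2 - 1) * (b\<^sup>2 * (real n * real m)) \<le> (\<tau>\<^sup>2 - 1) * ?T"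
                using elim \<tau>2 by (intro mult_left_mono) auto
              then show "D * (real n * real m) \<le> (\<tau>\<^sup>2 - 1) * ?T"
                by (simp add: D_def mult.assoc)
              have "\<bar>?U\<bar> * (1 + \<tau>\<^sup>2) \<le> \<beta> * (real n * real m) * (1 + \<tau>\<^sup>2)"
                using that \<omega> by (intro mult_right_mono) auto
              also have "\<dots> = \<beta> * (1 + \<tau>\<^sup>2) * (real n * real m)" by (simp only: mult_ac)
              finally show "\<bar>?U\<bar> * (1 + \<tau>\<^sup>2) \<le> D / 2 * (real n * real m)"
                unfolding \<beta>D .
              show "\<bar>?V \<omega>\<bar> \<le> D * c / 8 * real n"
                using that \<omega> by auto
            qed (rule J)
            also have "\<dots> = ?\<kappa>\<^sup>2"
              using noise_level_est_data(1)[OF m n, of yhat \<omega>] noise_level_est_data(2)[OF m n, of \<omega>]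
              by (simp add: power_mult_distrib)
            finally show "(\<Sum>l\<in>{J + 1..m}. (?y l)\<^sup>2) \<le> ?\<kappa>\<^sup>2" .
          qed
          then show "\<omega> \<in> ?E m n \<or> \<omega> \<in> ?B \<or> \<omega> \<in> ?B'"
            using \<omega> by blast
        qed
      qed
    qed measurable
    moreover have "prob ?B \<le> 2 / \<beta>\<^sup>2 / real m"
    proof -
      have "prob ?B \<le> 2 * real (card {1..m}) * (real n)\<^sup>2 / (\<beta> * (real n * real m))\<^sup>2"
        using \<beta> m n by (intro prob_cross_sum) auto
      also have "\<dots> = 2 / \<beta>\<^sup>2 / real m"
        using \<beta> m n by (simp add: field_simps power2_eq_square)
      finally show ?thesis .
    qed
    moreover have "prob ?B' \<le> R / real n"
    proof -
      have "prob ?B' \<le> real n * (\<Sum>l\<in>{J + 1..m}. (coord yhat l)\<^sup>2) / (D * c / 8 * real n)\<^sup>2"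
        using D c n by (intro prob_weighted_sum) auto
      also have "\<dots> \<le> real n * (norm yhat)\<^sup>2 / (D * c / 8 * real n)\<^sup>2"
        by (intro divide_right_mono mult_left_mono norm_ell2_sq_ge) auto
      also have "\<dots> = R / real n"
        using D c n by (simp add: R_def field_simps power2_eq_square)
      finally show ?thesis .
    qed
    ultimately show ?thesis by (simp add: prob_space)
  qed
  have lim: "((\<lambda>p. 1 - 2 / \<beta>\<^sup>2 / real (fst p) - R / real (snd p)) \<longlongrightarrow> 1 - 0 - 0) (mn_filter c)"
    by (intro tendsto_intros tendsto_divide_0[OF tendsto_const]
        filterlim_at_top_imp_at_infinity
        filterlim_compose[OF filterlim_real_sequentially] filterlim_mn_filter)
  then have lim1: "((\<lambda>p. 1 - 2 / \<beta>\<^sup>2 / real (fst p) - R / real (snd p)) \<longlongrightarrow> 1) (mn_filter c)"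
    by simp
  have "((\<lambda>(m, n). prob (?E m n)) \<longlongrightarrow> 1) (mn_filter c)"
  proof (rule tendsto_sandwich[OF _ _ lim1 tendsto_const])
    show "\<forall>\<^sub>F p in mn_filter c. 1 - 2 / \<beta>\<^sup>2 / real (fst p) - R / real (snd p) \<le> (case p of (m, n) \<Rightarrow> prob (?E m n))"
      by (rule eventually_mn_filterI[of "\<lambda>_. True"]) (use lower in auto)
  qed (auto intro!: always_eventually)
  moreover have "C > 0" using x[OF j] by (simp add: C_def)
  ultimately show ?thesis by blast
qed

end

section \<open>Claim (b): the known noise level\<close>

lemma filterlim_nat_floor_sqrt: "filterlim (\<lambda>m. real (nat \<lfloor>sqrt (real m)\<rfloor>)) at_top sequentially"
proof (rule filterlim_at_top_mono)
  show "filterlim (\<lambda>m. - 1 + sqrt (real m)) at_top sequentially"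
    by (rule filterlim_tendsto_add_at_top[OF tendsto_const
          filterlim_compose[OF sqrt_at_top filterlim_real_sequentially]])
  show "\<forall>\<^sub>F m in sequentially. - 1 + sqrt (real m) \<le> real (nat \<lfloor>sqrt (real m)\<rfloor>)"
    by (intro always_eventually allI) linarith
qed

text \<open>From \<open>n \<le> m / c\<close> follows
  \<open>(n * m) powr r \<ge> c powr (1 - r) * n * m powr (2 * r - 1)\<close>, and
  \<open>2 * r - 1 > 1 / 2\<close> beats \<open>n * sqrt m\<close>. Here the constraint on
  \<open>m / n\<close> enters.\<close>

lemma jump_dominates:
  fixes c x A r :: real
  assumes c: "c > 0" and x: "x > 0" and r: "3 / 4 < r" "r < 1"
  shows "\<forall>\<^sub>F m in sequentially. \<forall>n k. 0 < n \<longrightarrow> c * n \<le> real m \<longrightarrow> n * real m / 2 \<le> k \<longrightarrow>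
    A * (n * sqrt (real m)) \<le> x * k powr r"
proof -
  define K where "K = A / (x * (1 / 2) powr r * c powr (1 - r))"
  have "\<forall>\<^sub>F m in sequentially. K \<le> real m powr (2 * r - 3 / 2)"
    using r by (intro eventually_le_powr filterlim_real_sequentially) auto
  then show ?thesis
    using eventually_gt_at_top[of 0]
  proof eventually_elim
    case (elim m)
    show ?case
    proof (intro allI impI)
      fix n k :: real
      assume n: "0 < n" "c * n \<le> real m" and k: "n * real m / 2 \<le> k"
      have m: "real m > 0" using elim by simp
      have "A \<le> x * (1 / 2) powr r * c powr (1 - r) * real m powr (2 * r - 3 / 2)"
        using elim x c by (simp add: K_def field_simps)
      then have "A * (n * sqrt (real m)) \<le>
          x * (1 / 2) powr r * c powr (1 - r) * real m powr (2 * r - 3 / 2) * (n * sqrt (real m))"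
        using n by (intro mult_right_mono) auto
      also have "\<dots> = x * (1 / 2) powr r * (n * (c powr (1 - r) * real m powr (2 * r - 1)))"
      proof -
        have "real m powr (2 * r - 3 / 2) * sqrt (real m) = real m powr (2 * r - 1)"
          using m by (simp add: powr_half_sqrt[symmetric] powr_add[symmetric])
        then show ?thesis by (simp add: mult_ac)
      qed
      also have "n * (c powr (1 - r) * real m powr (2 * r - 1)) \<le> n powr r * real m powr r"
      proof -
        have "n = n powr r * n powr (1 - r)"
          using n by (simp add: powr_add[symmetric])
        then have "n * (c powr (1 - r) * real m powr (2 * r - 1)) =
            n powr r * ((c * n) powr (1 - r) * real m powr (2 * r - 1))"
          using n c by (simp add: powr_mult mult_ac)
        also have "\<dots> \<le> n powr r * (real m powr (1 - r) * real m powr (2 * r - 1))"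
          using n c r by (intro mult_left_mono mult_right_mono powr_mono2) auto
        also have "real m powr (1 - r) * real m powr (2 * r - 1) = real m powr r"
          by (simp add: powr_add[symmetric])
        finally show ?thesis .
      qed
      also have "x * (1 / 2) powr r * (n powr r * real m powr r) = x * (n * real m / 2) powr r"
        using n m by (simp add: powr_mult powr_divide)
      also have "\<dots> \<le> x * k powr r"
        using k n m x r by (intro mult_left_mono powr_mono2) auto
      finally show "A * (n * sqrt (real m)) \<le> x * k powr r"
        using x by (simp add: mult_left_mono)
    qed
  qed
qed

context diagonal_noise
begin

text \<open>The conclusion of \<open>big_jump\<close> is taken as a hypothesis so that
  \<open>p\<close>, \<open>x\<close> and the size bound are fixed beforehand. Two bad events cost
  \<open>p / 4\<close> each.\<close>

lemma divergence_known_noise_level: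
  assumes q1: "q > 1" and \<epsilon>2: "\<epsilon> < 2 / 3" and \<theta>: "0 < \<theta>" "\<theta> < 1" and c: "c > 0" and L: "L > 0"
    and p: "p > 0" and x: "x > 0"
    and jump: "\<And>I. finite I \<Longrightarrow> I \<subseteq> {1..} \<times> {1..} \<Longrightarrow> N\<^sub>0 \<le> card I \<Longrightarrow>
      p \<le> prob {\<omega>\<in>space M. real (card I) + x * real (card I) powr (2 / (2 + \<epsilon>)) \<le> (\<Sum>p\<in>I. (X p \<omega>)\<^sup>2)}"
  shows "\<forall>\<^sub>F (m, n) in mn_filter c. p / 2 \<le> prob {\<omega>\<in>space M.
    L \<le> err \<theta> m n 0 0 (\<lambda>\<omega>. sqrt ((real m + sqrt (real m)) / real n)) \<omega>}"
proof -
  define r where "r = 2 / (2 + \<epsilon>)"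
  \<comment> \<open>Solved from \<open>2 / A\<^sup>2 = p / 4\<close>, the Chebyshev bound for the
    cross terms of the upper block.\<close>
  define A where "A = sqrt (8 / p)"
  \<comment> \<open>Small enough that omitting \<open>2 * J\<close> columns costs only the order
    \<open>n * sqrt m\<close>, and large enough that \<open>J^2\<close> is comparable to
    \<open>m\<close>, hence at least a multiple of \<open>n\<close>.\<close>
  define J where "J m = nat \<lfloor>sqrt (real m)\<rfloor>" for m
  have r: "3 / 4 < r" "r < 1" using \<epsilon> \<epsilon>2 by (auto simp: r_def field_simps)
  have A: "A > 0" "A\<^sup>2 = 8 / p" using p by (auto simp: A_def)
  have J_le: "real (J m) \<le> sqrt (real m)" for m
    unfolding J_def by (rule of_nat_floor) simp
  have J_ge: "sqrt (real m) < real (J m) + 1" for m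
    unfolding J_def by linarith
  have Jlim: "filterlim (\<lambda>m. real (J m)) at_top sequentially"
    unfolding J_def by (rule filterlim_nat_floor_sqrt)
  \<comment> \<open>\<open>64 \<le> m\<close> gives \<open>4 * J \<le> m\<close>, so half of the
    columns remain, and \<open>2 * N\<^sub>0 \<le> m\<close> then leaves enough observations for the
    jump. The fourth condition bounds the probability of \<open>?B'\<close> by \<open>p / 4\<close>;
    the last one, available since \<open>q > 1\<close>, lifts the amplified noise above
    \<open>L\<close>.\<close>
  have "\<forall>\<^sub>F m in sequentially. 64 \<le> m \<and> 2 * N\<^sub>0 \<le> m \<and>
      (\<forall>n k. 0 < n \<longrightarrow> c * n \<le> real m \<longrightarrow> n * real m / 2 \<le> k \<longrightarrow> (3 + A) * (n * sqrt (real m)) \<le> x * k powr r) \<and>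
      32 / (p * b ^ 4) \<le> real (J m) \<and> 8 * L\<^sup>2 / (b\<^sup>2 * c) \<le> real (J m) powr (q - 1)"
    using Jlim q1 unfolding filterlim_at_top
    by (intro eventually_conj eventually_ge_at_top jump_dominates[OF c x r] eventually_le_powr[OF Jlim]) auto
  then show ?thesis
  proof (rule eventually_mn_filterI)
    fix m n :: nat
    assume m: "64 \<le> m \<and> 2 * N\<^sub>0 \<le> m \<and>
      (\<forall>n k. 0 < n \<longrightarrow> c * n \<le> real m \<longrightarrow> n * real m / 2 \<le> k \<longrightarrow> (3 + A) * (n * sqrt (real m)) \<le> x * k powr r) \<and>
      32 / (p * b ^ 4) \<le> real (J m) \<and> 8 * L\<^sup>2 / (b\<^sup>2 * c) \<le> real (J m) powr (q - 1)"
      and n: "2 \<le> n" and mn: "c * real n \<le> real m"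
    let ?j = "J m" and ?s = "sqrt (real m)"
    let ?L1 = "{?j + 1..2 * ?j}" and ?L2 = "{2 * ?j + 1..m}"
    let ?\<kappa> = "sqrt ((real m + ?s) / real n)"
    let ?k = "real (n * (m - 2 * ?j))"
    have s8: "?s \<ge> 8" using m real_sqrt_le_mono[of 64 "real m"] by simp
    have ss: "?s * ?s = real m" by simp
    have s4: "4 * real ?j \<le> real m"
      using J_le[of m] mult_right_mono[OF s8, of ?s] ss s8 by linarith
    then have j2: "2 * ?j \<le> m" by linarith
    have j1: "real ?j \<ge> 1" using J_ge[of m] s8 by linarith
    have k: "?k = real n * real m - 2 * (real n * real ?j)"
      using j2 by (simp add: of_nat_diff algebra_simps)
    have k2: "real n * real m / 2 \<le> ?k"
      using mult_left_mono[OF s4, of "real n"] unfolding k by (simp add: algebra_simps)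
    have N0: "N\<^sub>0 \<le> n * (m - 2 * ?j)"
    proof -
      have "real N\<^sub>0 \<le> real m / 2" using m by linarith
      also have "\<dots> \<le> real n * real m / 2"
        using n mult_right_mono[of 1 "real n" "real m / 2"] by simp
      finally show ?thesis using k2 by linarith
    qed
    have dom: "(3 + A) * (real n * ?s) \<le> x * ?k powr r"
      using m n mn k2 by auto
    have sub: "?L1 \<subseteq> {1..}" "?L2 \<subseteq> {1..}" by auto
    have [measurable]: "cross_sum n ?L1 \<in> borel_measurable M" "cross_sum n ?L2 \<in> borel_measurable M"
      "sq_sum n ?L2 \<in> borel_measurable M"
      using sub by (intro sq_sum_measurable cross_sum_measurable; auto)+
    let ?err = "err \<theta> m n 0 0 (\<lambda>\<omega>. ?\<kappa>)"
    have [measurable]: "?err \<in> borel_measurable M"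
      using n by (intro err_measurable \<theta>) auto
    let ?G = "{\<omega>\<in>space M. ?k + x * ?k powr r \<le> sq_sum n ?L2 \<omega>}"
    let ?E = "{\<omega>\<in>space M. L \<le> ?err \<omega>}"
    let ?B = "{\<omega>\<in>space M. A * (real n * ?s) \<le> \<bar>cross_sum n ?L2 \<omega>\<bar>}"
    \<comment> \<open>Half of the almost sure lower bound for the squares in the block
      \<open>?L1\<close>, so the other half survives its cross terms.\<close>
    let ?B' = "{\<omega>\<in>space M. b\<^sup>2 * real n * real ?j / 2 \<le> \<bar>cross_sum n ?L1 \<omega>\<bar>}"
    have "p \<le> prob ?G"
    proof -
      have card: "card ({1..n} \<times> ?L2) = n * (m - 2 * ?j)"
        by (simp add: card_cartesian_product)
      have "p \<le> prob {\<omega>\<in>space M. real (card ({1..n} \<times> ?L2)) +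
          x * real (card ({1..n} \<times> ?L2)) powr (2 / (2 + \<epsilon>)) \<le> (\<Sum>p\<in>{1..n} \<times> ?L2. (X p \<omega>)\<^sup>2)}"
        using N0 by (intro jump) (auto simp: card)
      then show ?thesis
        unfolding card r_def[symmetric] sq_sum_def .
    qed
    also have "prob ?G \<le> prob ?E + prob ?B + prob ?B'"
    proof (rule prob_le_of_cover)
      have "AE \<omega> in M. b\<^sup>2 * (real n * real (card ?L1)) \<le> sq_sum n ?L1 \<omega>"
        using sub by (intro AE_sq_sum_ge) auto
      then show "AE \<omega> in M. \<omega> \<in> ?G \<longrightarrow> \<omega> \<in> ?E \<or> \<omega> \<in> ?B \<or> \<omega> \<in> ?B'"
      proof eventually_elim
        case (elim \<omega>)
        let ?y = "sample_mean n (data m 0 \<omega>)"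
        have y: "?y l = col_sum n l \<omega> / real n" if "l \<in> {1..m}" for l
          using that n by (simp add: sample_mean_data)
        have \<kappa>0: "0 \<le> ?\<kappa>" by simp
        have "L \<le> ?err \<omega>"
          if G: "\<omega> \<in> ?G" and B: "\<omega> \<notin> ?B" and B': "\<omega> \<notin> ?B'"
        proof -
          have U2: "- cross_sum n ?L2 \<omega> < A * (real n * ?s)"
            and U1: "- cross_sum n ?L1 \<omega> < b\<^sup>2 * real n * real ?j / 2"
            using G B B' by auto
          have nj: "real n * real ?j \<le> real n * ?s"
            using J_le by (rule mult_left_mono) simp
          have "?\<kappa>\<^sup>2 = real n * (real m + ?s) / (real n)\<^sup>2"
            using n by (simp add: power2_eq_square)
          also have "\<dots> < (sq_sum n ?L2 \<omega> + cross_sum n ?L2 \<omega>) / (real n)\<^sup>2"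
          proof (rule divide_strict_right_mono)
            have "?k + x * ?k powr r \<le> sq_sum n ?L2 \<omega>" using G by simp
            \<comment> \<open>Of the \<open>3 + A\<close> multiples of \<open>n * ?s\<close> in
              \<open>dom\<close>, two replace the omitted columns, one pays for the slack in the
              threshold and \<open>A\<close> for the cross terms.\<close>
            then show "real n * (real m + ?s) < sq_sum n ?L2 \<omega> + cross_sum n ?L2 \<omega>"
              using U2 dom nj unfolding k distrib_left distrib_right by linarith
          qed (use n in auto)
          also have "\<dots> = (\<Sum>l\<in>?L2. (col_sum n l \<omega>)\<^sup>2) / (real n)\<^sup>2"
            by (simp add: sum_col_sum_sq)
          also have "\<dots> = (\<Sum>l\<in>?L2. (?y l)\<^sup>2)"
            unfolding sum_divide_distrib by (intro sum.cong refl) (auto simp: y power_divide)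
          finally have tail: "?\<kappa>\<^sup>2 < (\<Sum>l\<in>?L2. (?y l)\<^sup>2)" .
          have "L\<^sup>2 \<le> real ?j powr q * (b\<^sup>2 * real n * real ?j / 2) / (real n)\<^sup>2"
          proof -
            \<comment> \<open>Thus \<open>c * n \<le> m \<le> 4 * J^2\<close>, which trades the
              division by \<open>n\<close> for one by \<open>J^2\<close> and leaves a multiple of
              \<open>J powr (q - 1)\<close>.\<close>
            have "?s \<le> 2 * real ?j" using J_ge[of m] j1 by linarith
            then have "?s * ?s \<le> (2 * real ?j) * (2 * real ?j)"
              using s8 by (intro mult_mono) auto
            then have cn: "c * real n \<le> 4 * (real ?j)\<^sup>2"
              using mn ss by (simp add: power2_eq_square)
            have "8 * L\<^sup>2 \<le> real ?j powr (q - 1) * (b\<^sup>2 * c)"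
              using m b_pos c by (simp add: field_simps)
            then have "8 * L\<^sup>2 * real n \<le> real ?j powr (q - 1) * (b\<^sup>2 * c) * real n"
              by (rule mult_right_mono) simp
            also have "\<dots> = real ?j powr (q - 1) * b\<^sup>2 * (c * real n)" by simp
            also have "\<dots> \<le> real ?j powr (q - 1) * b\<^sup>2 * (4 * (real ?j)\<^sup>2)"
              using cn by (rule mult_left_mono) simp
            also have "\<dots> = 4 * b\<^sup>2 * (real ?j powr q * real ?j)"
            proof -
              have "real ?j powr (q - 1) * real ?j = real ?j powr q"
                using j1 powr_mult_base[of "real ?j" "q - 1"] by (simp add: mult.commute)
              then show ?thesis by (simp add: power2_eq_square)
            qed
            finally have "L\<^sup>2 * real n \<le> b\<^sup>2 * (real ?j powr q * real ?j) / 2" by linarith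
            then have "L\<^sup>2 * real n / real n \<le> b\<^sup>2 * (real ?j powr q * real ?j) / 2 / real n"
              by (rule divide_right_mono) simp
            then show ?thesis
              using n by (simp add: power2_eq_square mult_ac)
          qed
          also have "\<dots> \<le> real ?j powr q * (\<Sum>l\<in>?L1. (col_sum n l \<omega>)\<^sup>2) / (real n)\<^sup>2"
          proof (intro divide_right_mono mult_left_mono)
            show "b\<^sup>2 * real n * real ?j / 2 \<le> (\<Sum>l\<in>?L1. (col_sum n l \<omega>)\<^sup>2)"
              using elim U1 by (simp add: sum_col_sum_sq)
          qed auto
          also have "\<dots> = (\<Sum>l\<in>?L1. real ?j powr q * (?y l)\<^sup>2)"
            unfolding sum_divide_distrib sum_distrib_left using j2
            by (intro sum.cong refl) (auto simp: y power_divide)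
          also have "\<dots> \<le> (\<Sum>l\<in>?L1. real l powr q * (?y l)\<^sup>2)"
            using q by (intro sum_mono mult_right_mono powr_mono2) auto
          also have "\<dots> \<le> (?err \<omega>)\<^sup>2"
            using error_ge_of_large_tail[OF \<theta> \<kappa>0 tail, of ?L1] by simp
          finally show ?thesis
            by (rule power2_le_imp_le) simp
        qed
        then show ?case by blast
      qed
    qed (use n in measurable)
    also have "prob ?B \<le> p / 4"
    proof -
      have "prob ?B \<le> 2 * real (card ?L2) * (real n)\<^sup>2 / (A * (real n * ?s))\<^sup>2"
      proof (intro prob_cross_sum sub)
        show "0 < A * (real n * ?s)" using A n m by (intro mult_pos_pos) auto
      qed auto
      also have "\<dots> \<le> 2 * real m * (real n)\<^sup>2 / (A * (real n * ?s))\<^sup>2"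
        by (intro divide_right_mono mult_right_mono mult_left_mono) auto
      also have "\<dots> = 2 / A\<^sup>2"
        using n m by (simp add: power_mult_distrib)
      also have "\<dots> = p / 4" using A by simp
      finally show ?thesis .
    qed
    also have "prob ?B' \<le> p / 4"
    proof -
      have "prob ?B' \<le> 2 * real (card ?L1) * (real n)\<^sup>2 / (b\<^sup>2 * real n * real ?j / 2)\<^sup>2"
        using b_pos n j1 by (intro prob_cross_sum sub) auto
      also have "\<dots> = 8 / (b ^ 4 * real ?j)"
        using n j1 b_pos by (simp add: field_simps power2_eq_square power4_eq_xxxx)
      also have "\<dots> \<le> p / 4"
        using m p b_pos j1 by (simp add: field_simps)
      finally show ?thesis .
    qed
    finally show "case (m, n) of (m, n) \<Rightarrow> p / 2 \<le> prob {\<omega>\<in>space M.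
        L \<le> err \<theta> m n 0 0 (\<lambda>\<omega>. sqrt ((real m + sqrt (real m)) / real n)) \<omega>}"
      by simp
  qed
qed

end

section \<open>Transfer to the hypotheses of the theorem and conclusion\<close>

lemma diagonal_opE:
  assumes "diagonal_op q K" "q > 0"
  obtains \<sigma> where "diagonal q K \<sigma>"
  using assms by (auto simp: diagonal_op_def diagonal_def)

lemma noise_of_iid_noise:
  assumes "iid_noise \<epsilon> M \<delta>" "0 < \<epsilon>" "\<epsilon> < 2"
  shows "noise M \<epsilon> (\<lambda>(i, j). \<delta> i j)"
  using assms by (auto simp: iid_noise_def noise_def noise_axioms_def)

text \<open>Dividing the data by \<open>\<sigma> j\<close> leaves coordinates with square
  \<open>j powr (-2)\<close>: summable, so the data lie in the range of \<open>K\<close>, and never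
  0, so whichever component is missed costs a positive error.\<close>

lemma (in diagonal) mp_inverse_source:
  assumes yhat: "yhat = (\<Sum>\<^sub>\<infinity>j\<in>{1..}. real j powr (- q / 2 - 1) *\<^sub>R basis_vec j)" and j: "j \<ge> 1"
  shows "coord (mp_inverse K yhat) j \<noteq> 0"
proof -
  let ?f = "\<lambda>j. real j powr (- q / 2 - 1)"
  have sq: "(?f j)\<^sup>2 = real j powr (- q - 2)" for j
    by (simp add: power2_eq_square powr_add[symmetric])
  have "summable (\<lambda>j. (?f j)\<^sup>2)"
    unfolding sq using q by (simp add: summable_real_powr_iff)
  then have y: "coord yhat j = ?f j" if "j \<ge> 1" for j
    unfolding yhat using that by (rule infsum_basis_vec)
  let ?x = "\<lambda>j. if j = 0 then 0 else ?f j / \<sigma> j"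
  have "summable (\<lambda>j. (?x j)\<^sup>2)"
  proof (rule summable_comparison_test')
    show "summable (\<lambda>j. real j powr (-2))" by (simp add: summable_real_powr_iff)
    show "norm ((?x j)\<^sup>2) \<le> real j powr (-2)" for j
    proof (cases "j = 0")
      case False
      then have "(?x j)\<^sup>2 = real j powr (- q - 2) / real j powr (- q)"
        using \<sigma>[of j] sq[of j] by (simp add: power_divide)
      also have "\<dots> = real j powr (-2)" by (simp add: powr_diff[symmetric])
      finally show ?thesis by simp
    qed simp
  qed
  then have x: "coord (Abs_ell2 ?x) j = ?x j" for j
    by (subst Abs_ell2_inverse) auto
  have "mp_inverse K yhat = Abs_ell2 ?x"
    using \<sigma>_nz by (intro coord_mp_inverse) (simp add: x y)
  then show ?thesis using j \<sigma>_nz[of j] by (simp add: x)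
qed

theorem theorem4p2:
  fixes \<epsilon> :: real
  assumes "0 < \<epsilon>" and "\<epsilon> < 2 / 11"
  shows
    "(\<forall>(q::real) (c::real) (\<theta>::real) (\<tau>::real) K (M :: 'a measure) \<delta> yhat.
        q > 1 \<longrightarrow> c > 0 \<longrightarrow> 0 < \<theta> \<longrightarrow> \<theta> < 1 \<longrightarrow> \<tau> > 1 \<longrightarrow>
        diagonal_op q K \<longrightarrow> iid_noise \<epsilon> M \<delta> \<longrightarrow>
        yhat = (\<Sum>\<^sub>\<infinity>j\<in>{1..}. real j powr (- q / 2 - 1) *\<^sub>R basis_vec j) \<longrightarrow>
        (\<exists>C>0.
          ((\<lambda>(m, n). measure M {\<omega> \<in> space M.
              (let Y = measurements m yhat \<delta> \<omega>;
                   \<alpha> = discrepancy_alpha m K \<theta> (\<tau> * noise_level_est m n Y) (sample_mean n Y)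
               in norm (spectral_cutoff m K \<alpha> (sample_mean n Y) - mp_inverse K yhat) \<ge> C)})
            \<longlongrightarrow> 1) (mn_filter c)))
     \<and>
     (\<exists>p::real. p > 0 \<and>
       (\<forall>(q::real) (c::real) (\<theta>::real) K (M :: 'a measure) \<delta> yhat.
          q > 1 \<longrightarrow> c > 0 \<longrightarrow> 0 < \<theta> \<longrightarrow> \<theta> < 1 \<longrightarrow>
          diagonal_op q K \<longrightarrow> iid_noise \<epsilon> M \<delta> \<longrightarrow> yhat = 0 \<longrightarrow>
          (\<forall>L>0.
            Liminf (mn_filter c) (\<lambda>(m, n). ereal (measure M {\<omega> \<in> space M.
              (let Y = measurements m yhat \<delta> \<omega>;
                   \<alpha> = discrepancy_alpha m K \<theta> (sqrt ((real m + sqrt (real m)) / real n))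
                         (sample_mean n Y)
               in norm (spectral_cutoff m K \<alpha> (sample_mean n Y) - mp_inverse K yhat) \<ge> L)}))
            > ereal p)))"
proof (intro conjI allI impI)
  fix q c \<theta> \<tau> :: real and K and M :: "'a measure" and \<delta> yhat
  assume q1: "q > 1" and c: "c > 0" and \<theta>: "0 < \<theta>" "\<theta> < 1" and \<tau>: "\<tau> > 1"
    and K: "diagonal_op q K" and iid: "iid_noise \<epsilon> M \<delta>"
    and yhat: "yhat = (\<Sum>\<^sub>\<infinity>j\<in>{1..}. real j powr (- q / 2 - 1) *\<^sub>R basis_vec j)"
  obtain \<sigma> where "diagonal q K \<sigma>" using diagonal_opE[OF K] q1 by auto
  moreover have "noise M \<epsilon> (\<lambda>(i, j). \<delta> i j)"
    using noise_of_iid_noise[OF iid] assms by simp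
  ultimately interpret diagonal_noise q K \<sigma> M \<epsilon> "\<lambda>(i, j). \<delta> i j"
    by (rule diagonal_noise.intro)
  show "\<exists>C>0. ((\<lambda>(m, n). measure M {\<omega> \<in> space M.
        (let Y = measurements m yhat \<delta> \<omega>;
             \<alpha> = discrepancy_alpha m K \<theta> (\<tau> * noise_level_est m n Y) (sample_mean n Y)
         in norm (spectral_cutoff m K \<alpha> (sample_mean n Y) - mp_inverse K yhat) \<ge> C)})
      \<longlongrightarrow> 1) (mn_filter c)"
    using no_convergence_estimated_noise_level[OF \<tau> \<theta> c mp_inverse_source[OF yhat]]
    by (simp add: Let_def)
next
  have \<epsilon>2: "\<epsilon> < 2" using assms by simp
  show "\<exists>p::real. p > 0 \<and>
       (\<forall>(q::real) (c::real) (\<theta>::real) K (M :: 'a measure) \<delta> yhat.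
          q > 1 \<longrightarrow> c > 0 \<longrightarrow> 0 < \<theta> \<longrightarrow> \<theta> < 1 \<longrightarrow>
          diagonal_op q K \<longrightarrow> iid_noise \<epsilon> M \<delta> \<longrightarrow> yhat = 0 \<longrightarrow>
          (\<forall>L>0.
            Liminf (mn_filter c) (\<lambda>(m, n). ereal (measure M {\<omega> \<in> space M.
              (let Y = measurements m yhat \<delta> \<omega>;
                   \<alpha> = discrepancy_alpha m K \<theta> (sqrt ((real m + sqrt (real m)) / real n))
                         (sample_mean n Y)
               in norm (spectral_cutoff m K \<alpha> (sample_mean n Y) - mp_inverse K yhat) \<ge> L)}))
            > ereal p))"
  \<comment> \<open>The constants depend on \<open>\<epsilon>\<close> alone and serve every
    probability space over the given type, so \<open>p\<close> can be chosen before
    \<open>q\<close>, \<open>c\<close>, \<open>\<theta>\<close>, \<open>K\<close> and the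
    noise.\<close>
  proof (rule big_jump[OF assms(1) \<epsilon>2, where ?'a = 'a])
    fix p x :: real and N\<^sub>0 :: nat
    assume p: "p > 0" and x: "x > 0"
      and jump: "\<And>(M :: 'a measure) X (I :: (nat \<times> nat) set). noise M \<epsilon> X \<Longrightarrow> finite I \<Longrightarrow>
        I \<subseteq> {1..} \<times> {1..} \<Longrightarrow> N\<^sub>0 \<le> card I \<Longrightarrow>
        measure M {\<omega>\<in>space M. real (card I) + x * real (card I) powr (2 / (2 + \<epsilon>)) \<le>
          (\<Sum>p\<in>I. (X p \<omega>)\<^sup>2)} \<ge> p"
    show ?thesis
    \<comment> \<open>The probabilities are eventually at least \<open>p / 2\<close>; a smaller
      witness makes the inequality for the lower limit strict.\<close>
    proof (intro exI[of _ "p / 4"] conjI allI impI)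
      fix q c \<theta> L :: real and K and M :: "'a measure" and \<delta> and yhat :: ell2
      assume q1: "q > 1" and c: "c > 0" and \<theta>: "0 < \<theta>" "\<theta> < 1"
        and K: "diagonal_op q K" and iid: "iid_noise \<epsilon> M \<delta>" and yhat: "yhat = 0" and L: "L > 0"
      obtain \<sigma> where "diagonal q K \<sigma>" using diagonal_opE[OF K] q1 by auto
      moreover have noise: "noise M \<epsilon> (\<lambda>(i, j). \<delta> i j)"
        using noise_of_iid_noise[OF iid] assms by simp
      ultimately interpret diagonal_noise q K \<sigma> M \<epsilon> "\<lambda>(i, j). \<delta> i j"
        by (rule diagonal_noise.intro)
      have K0: "mp_inverse K 0 = 0" by (rule coord_mp_inverse) simp
      let ?P = "\<lambda>m n. measure M {\<omega> \<in> space M.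
          (let Y = measurements m yhat \<delta> \<omega>;
               \<alpha> = discrepancy_alpha m K \<theta> (sqrt ((real m + sqrt (real m)) / real n)) (sample_mean n Y)
           in norm (spectral_cutoff m K \<alpha> (sample_mean n Y) - mp_inverse K yhat) \<ge> L)}"
      have "\<forall>\<^sub>F (m, n) in mn_filter c. p / 2 \<le> ?P m n"
        using divergence_known_noise_level[OF q1 _ \<theta> c L p x jump[OF noise]] assms
        by (simp add: Let_def yhat K0)
      then have "ereal (p / 2) \<le> Liminf (mn_filter c) (\<lambda>(m, n). ereal (?P m n))"
        by (intro Liminf_bounded) (auto elim!: eventually_mono)
      moreover have "ereal (p / 4) < ereal (p / 2)" using p by simp
      ultimately show "ereal (p / 4) < Liminf (mn_filter c) (\<lambda>(m, n). ereal (?P m n))"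
        by (rule less_le_trans[rotated])
    qed (use p in simp)
  qed
qed

end
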